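(* Let $(\mathcal{S},\mathcal{A},r,p_\theta)$, $\theta\in\Theta$, be a family of Markov decision processes with true parameter $\theta_0\in\Theta$, and let $\pi$ be a policy. Suppose there exist two positive integers $k$ and $l$, a non-increasing sequence of positive numbers $\{\alpha_i\}_{i\ge0}$ and two non-negative functions $\mu,\nu$ on $\mathcal{S}\times\mathcal{A}$ such that for all $\theta\in\Theta$, all $i\ge0$ and all possible $\widetilde{H}_i$, $$\alpha_i\,\mu(\cdot,\cdot)\le\frac1k\sum_{j=1}^k p^{\widetilde{H}_i,j}_{\theta,\pi}(\cdot,\cdot),\qquad p^{\widetilde{H}_i,l}_{\theta,\pi}(\cdot,\cdot)\le\nu(\cdot,\cdot).$$ Let $K>0$ and $\xi\in(0,1)$ be testing constants for $(k,l,\{\alpha_i\},\mu,\nu)$ in the sense of the context. Let $n$ be a fixed positive integer, and for each $t$ let $P_t$ be a prior on $\Theta$. Let $\epsilon_t>0$, $\epsilon_t\to0$, put $\bar\epsilon_t=\big(\sum_{i=0}^{\lfloor t/(k+l)\rfloor-1}\alpha_{i(k+l)}\,\epsilon_t^2/t\big)^{1/2}$, and suppose $1/(t\bar\epsilon_t^2)=\mathcal{O}(1)$ and that, for every sufficiently large $j\in\mathbb{N}$ and every $t\geq k+l$, $$\sup_{\epsilon>\epsilon_t}\log N\Big(\tfrac12\,\alpha^{1/2}_{(\lfloor t/(k+l)\rfloor-1)(k+l)}\,\xi\,\epsilon,\ \{\theta\in\Theta:d_\mu(\theta,\theta_0)<\epsilon\},\ d_\nu\Big)\le t\bar\epsilon_t^2,$$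 $$\frac{P_t(\theta\in\Theta:\ j\epsilon_t<d_\mu(\theta,\theta_0)\le(j+1)\epsilon_t)}{P_t(B_t(\theta_0,\bar\epsilon_t;n))}\le\exp\{Kt\bar\epsilon_t^2j^2/2\}.$$ Then for every $M_t\to\infty$, $$P_t(\theta\in\Theta:\ d_\mu(\theta,\theta_0)>M_t\epsilon_t\mid H_t)\to0\quad\text{in }P_{\theta_0,\pi}\text{-probability}$$ as $t\to\infty$.
   Context: A Markov decision process (MDP) $(\mathcal{S},\mathcal{A},r,p_\theta)$ has state space $\mathcal{S}$, action space $\mathcal{A}$, reward function $r:\mathcal{S}\times\mathcal{A}\to\mathbb{R}$ and transition density $p_\theta(S_{t+1}|S_t,A_t)$ (with respect to a measure $m$ on $\mathcal{S}$), the conditional density of $S_{t+1}$ given $S_t,A_t$, for $t\in\{0,1,2,\dots\}$, indexed by $\theta\in\Theta$, where $\Theta$ may be infinite dimensional. The reward is $R_t=r(S_t,A_t)$. The history up to time $t$ is $H_t=(S_0,A_0,R_0,\dots,S_{t-1},A_{t-1},R_{t-1},S_t)$, and $\widetilde{H}_t=(H_t,A_t,R_t)$. A policy $\pi$ is an infinite sequence of functions $\pi_t$ mapping histories $H_t$ to probability distributions on $\mathcal{A}$; under $\pi$ the action $A_t$ is drawn from $\pi_t(H_t)$. $P_{\theta,\pi}$ and $\mathbb{E}_{\theta,\pi}$ are the probability and expectation induced by the dynamics $\theta$ and the policy $\pi$, and $p^{(t)}_{\theta,\pi}$ is the density of $H_t$ under $P_{\theta,\pi}$. For $i,j\ge0$,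 $p^{\widetilde{H}_i,j}_{\theta,\pi}$ is the density, with respect to a reference finite measure $\lambda$ on $\mathcal{S}\times\mathcal{A}$, of the conditional distribution of $(S_{i+j},A_{i+j})$ given $\widetilde{H}_i$ under $P_{\theta,\pi}$. The data $H_t$ are generated from $P_{\theta_0,\pi}$, and $P_t(\cdot|H_t)$ is the posterior distribution of $\theta$ given $H_t$ under the prior $P_t$. For a non-negative function $\mu$ on $\mathcal{S}\times\mathcal{A}$ the semi-distance $d_\mu$ on $\Theta$ is $$d_\mu^2(\theta,\theta')=\int h^2\big(p_\theta(\cdot|s,a),p_{\theta'}(\cdot|s,a)\big)\mu(s,a)\,d\lambda(s,a),\quad h^2(p_1,p_2)=\int(\sqrt{p_1(x)}-\sqrt{p_2(x)})^2\,dm(x);$$ $d_\nu$ is defined likewise. $N(\epsilon,\Theta',d)$ is the $\epsilon$-covering number of $\Theta'$, the minimal number of $d$-balls of radius $\epsilon$ needed to cover $\Theta'$. $K(p_1;p_2)=\mathbb{E}_{p_1}\log\frac{p_1(X)}{p_2(X)}$ is the Kullback–Leibler divergence, $V_n(p_1;p_2)=\mathbb{E}_{p_1}\big|\log\frac{p_1(X)}{p_2(X)}-K(p_1;p_2)\big|^n$, and $$B_t(\theta_0,\epsilon;n)=\{\theta\in\Theta:\ K(p^{(t)}_{\theta_0,\pi};p^{(t)}_{\theta,\pi})\le t\epsilon^2,\ V_n(p^{(t)}_{\theta_0,\pi};p^{(t)}_{\theta,\pi})\le t^{n/2}\epsilon^n\}.$$ Testing constants: $K>0$ and $\xi\in(0,1)$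 are constants with the following property (such constants exist under the stated two-sided density bounds). For every $t\ge k+l$ and every $\theta_1\in\Theta$ there is a test $\phi_t$ (a measurable $[0,1]$-valued function of $H_t$) such that, whatever the distribution of $S_0$, both $\mathbb{E}_{\theta_0,\pi}\phi_t$ and $\sup_{\theta\in B}\mathbb{E}_{\theta,\pi}(1-\phi_t)$ are at most $\exp\{-K\sum_{i=0}^{\lfloor t/(k+l)\rfloor-1}\alpha_{i(k+l)}d_\mu^2(\theta_0,\theta_1)\}$, where $B=\{\theta\in\Theta:d_\nu(\theta,\theta_1)\le\xi\,\alpha^{1/2}_{(\lfloor t/(k+l)\rfloor-1)(k+l)}\,d_\mu(\theta_0,\theta_1)\}$. *)

theory Defs
  imports "HOL-Probability.Probability" "HOL-Library.Landau_Symbols"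
begin

section \<open>Families of Markov decision processes\<close>

text \<open>
  \<open>State\<close> carries both the sigma-algebra of the state space and the reference measure \<open>m\<close>;
  of \<open>Action\<close> and \<open>Param\<close> only the sigma-algebra matters. \<open>Trans M \<theta> (s, a)\<close> is the transition
  density with respect to \<open>m\<close>.
\<close>

record ('p, 's, 'a) mdp_family =
  Param :: "'p measure"
  State :: "'s measure"
  Action :: "'a measure"
  Reward :: "'s \<times> 'a \<Rightarrow> real"
  Trans :: "'p \<Rightarrow> 's \<times> 'a \<Rightarrow> 's \<Rightarrow> real"

abbreviation SA :: "('p, 's, 'a) mdp_family \<Rightarrow> ('s \<times> 'a) measure" where
  "SA M \<equiv> State M \<Otimes>\<^sub>M Action M"

definition is_mdp_family :: "('p, 's, 'a) mdp_family \<Rightarrow> bool" where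
  "is_mdp_family M \<longleftrightarrow>
     sigma_finite_measure (State M) \<and>
     Reward M \<in> borel_measurable (SA M) \<and>
     (\<lambda>(\<theta>, z, s'). Trans M \<theta> z s') \<in> borel_measurable (Param M \<Otimes>\<^sub>M (SA M \<Otimes>\<^sub>M State M)) \<and>
     (\<forall>\<theta>\<in>space (Param M). \<forall>z\<in>space (SA M).
        (\<forall>s'\<in>space (State M). 0 \<le> Trans M \<theta> z s') \<and>
        (\<integral>\<^sup>+s'. ennreal (Trans M \<theta> z s') \<partial>State M) = 1)"


section \<open>Histories, policies and the law of the process\<close>

text \<open>
  The \<open>i\<close>-th coordinate of a trajectory is \<open>(S\<^sub>i, A\<^sub>i, R\<^sub>i)\<close>. The history
  \<open>H\<^sub>t\<close> is the pair of the coordinates below \<open>t\<close> and the state \<open>S\<^sub>t\<close>; the extended history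
  \<open>(H\<^sub>t, A\<^sub>t, R\<^sub>t)\<close> consists of the coordinates up to and including \<open>t\<close>.
\<close>

type_synonym ('s, 'a) trajectory = "nat \<Rightarrow> 's \<times> 'a \<times> real"
type_synonym ('s, 'a) history = "('s, 'a) trajectory \<times> 's"
type_synonym ('s, 'a) policy = "nat \<Rightarrow> ('s, 'a) history \<Rightarrow> 'a measure"

abbreviation step_space :: "('p, 's, 'a) mdp_family \<Rightarrow> ('s \<times> 'a \<times> real) measure" where
  "step_space M \<equiv> State M \<Otimes>\<^sub>M (Action M \<Otimes>\<^sub>M borel)"

abbreviation ext_hist_space :: "('p, 's, 'a) mdp_family \<Rightarrow> nat \<Rightarrow> ('s, 'a) trajectory measure" where
  "ext_hist_space M t \<equiv> PiM {0..<Suc t} (\<lambda>_. step_space M)"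

abbreviation hist_space :: "('p, 's, 'a) mdp_family \<Rightarrow> nat \<Rightarrow> ('s, 'a) history measure" where
  "hist_space M t \<equiv> PiM {0..<t} (\<lambda>_. step_space M) \<Otimes>\<^sub>M State M"

definition hist :: "nat \<Rightarrow> ('s, 'a) trajectory \<Rightarrow> ('s, 'a) history" where
  "hist t \<omega> = (restrict \<omega> {0..<t}, fst (\<omega> t))"

definition state_action :: "nat \<Rightarrow> ('s, 'a) trajectory \<Rightarrow> 's \<times> 'a" where
  "state_action i \<omega> = (fst (\<omega> i), fst (snd (\<omega> i)))"

definition is_policy :: "('p, 's, 'a) mdp_family \<Rightarrow> ('s, 'a) policy \<Rightarrow> bool" where
  "is_policy M \<pi> \<longleftrightarrow> (\<forall>t. \<pi> t \<in> hist_space M t \<rightarrow>\<^sub>M prob_algebra (Action M))"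

text \<open>The initial distribution \<open>\<rho>\<close> of \<open>S\<^sub>0\<close> does not depend on the parameter.\<close>

definition state_kernel ::
  "('p, 's, 'a) mdp_family \<Rightarrow> 's measure \<Rightarrow> 'p \<Rightarrow> nat \<Rightarrow> ('s, 'a) trajectory \<Rightarrow> 's measure" where
  "state_kernel M \<rho> \<theta> i x =
     (if i = 0 then \<rho>
      else density (State M) (\<lambda>s'. ennreal (Trans M \<theta> (state_action (i - 1) x) s')))"

definition step_kernel ::
  "('p, 's, 'a) mdp_family \<Rightarrow> 's measure \<Rightarrow> ('s, 'a) policy \<Rightarrow> 'p \<Rightarrow> nat \<Rightarrow> ('s, 'a) trajectory
    \<Rightarrow> ('s \<times> 'a \<times> real) measure" where
  "step_kernel M \<rho> \<pi> \<theta> i x =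
     do { s \<leftarrow> state_kernel M \<rho> \<theta> i x;
          a \<leftarrow> \<pi> i (x, s);
          return (step_space M) (s, a, Reward M (s, a)) }"

lemma measurable_state_action:
  assumes "i \<in> I"
  shows "state_action i \<in> PiM I (\<lambda>_. step_space M) \<rightarrow>\<^sub>M SA M"
  unfolding state_action_def using assms by measurable

lemma measurable_state_kernel:
  assumes M: "is_mdp_family M" and \<rho>: "\<rho> \<in> space (prob_algebra (State M))"
    and \<theta>: "\<theta> \<in> space (Param M)"
  shows "state_kernel M \<rho> \<theta> i \<in> PiM {0..<i} (\<lambda>_. step_space M) \<rightarrow>\<^sub>M prob_algebra (State M)"
proof (cases "i = 0")
  case True
  then show ?thesis using \<rho> by (simp add: state_kernel_def[abs_def])
next
  case False
  let ?X = "PiM {0..<i} (\<lambda>_. step_space M)"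
  interpret sigma_finite_measure "State M" using M by (simp add: is_mdp_family_def)
  have sa[measurable]: "state_action (i - 1) \<in> ?X \<rightarrow>\<^sub>M SA M"
    using False by (intro measurable_state_action) auto
  have T[measurable]:
    "(\<lambda>(\<theta>, z, s'). Trans M \<theta> z s') \<in> borel_measurable (Param M \<Otimes>\<^sub>M (SA M \<Otimes>\<^sub>M State M))"
    using M by (simp add: is_mdp_family_def)
  have "(\<lambda>(x, s'). (\<theta>, state_action (i - 1) x, s'))
      \<in> ?X \<Otimes>\<^sub>M State M \<rightarrow>\<^sub>M Param M \<Otimes>\<^sub>M (SA M \<Otimes>\<^sub>M State M)"
    using \<theta> by measurable
  from measurable_compose[OF this T]
  have J[measurable]: "(\<lambda>(x, s'). Trans M \<theta> (state_action (i - 1) x) s')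
      \<in> borel_measurable (?X \<Otimes>\<^sub>M State M)"
    by (simp add: case_prod_beta)
  have P: "prob_space (state_kernel M \<rho> \<theta> i x)" if x: "x \<in> space ?X" for x
  proof -
    have z: "state_action (i - 1) x \<in> space (SA M)" using measurable_space[OF sa x] .
    have "(\<lambda>s'. Trans M \<theta> (state_action (i - 1) x) s') \<in> borel_measurable (State M)"
      using measurable_compose[OF measurable_Pair1'[OF x, of "State M"] J] by simp
    then show ?thesis using M z \<theta> False
      by (auto simp: state_kernel_def is_mdp_family_def emeasure_density
          intro!: prob_spaceI nn_integral_cong[THEN trans])
  qed
  show ?thesis
  proof (rule measurable_prob_algebraI)
    show "state_kernel M \<rho> \<theta> i \<in> ?X \<rightarrow>\<^sub>M subprob_algebra (State M)"
    proof (rule measurable_subprob_algebra)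
      fix A assume A[measurable]: "A \<in> sets (State M)"
      have "(\<lambda>x. \<integral>\<^sup>+s'. ennreal (Trans M \<theta> (state_action (i - 1) x) s') * indicator A s' \<partial>State M)
          \<in> borel_measurable ?X"
        by measurable
      moreover have "emeasure (state_kernel M \<rho> \<theta> i x) A
          = (\<integral>\<^sup>+s'. ennreal (Trans M \<theta> (state_action (i - 1) x) s') * indicator A s' \<partial>State M)"
        if x: "x \<in> space ?X" for x
      proof -
        have "(\<lambda>s'. Trans M \<theta> (state_action (i - 1) x) s') \<in> borel_measurable (State M)"
          using measurable_compose[OF measurable_Pair1'[OF x, of "State M"] J] by simp
        then show ?thesis using False by (simp add: state_kernel_def emeasure_density)
      qed
      ultimately show "(\<lambda>x. emeasure (state_kernel M \<rho> \<theta> i x) A) \<in> borel_measurable ?X"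
        by (simp cong: measurable_cong)
    qed (use P False in \<open>auto simp: prob_space_imp_subprob_space state_kernel_def\<close>)
  qed (use P in auto)
qed

lemma measurable_step_kernel:
  assumes M: "is_mdp_family M" and \<pi>: "is_policy M \<pi>"
    and \<rho>: "\<rho> \<in> space (prob_algebra (State M))" and \<theta>: "\<theta> \<in> space (Param M)"
  shows "step_kernel M \<rho> \<pi> \<theta> i \<in> PiM {0..<i} (\<lambda>_. step_space M) \<rightarrow>\<^sub>M prob_algebra (step_space M)"
proof -
  note [measurable] = measurable_state_kernel[OF M \<rho> \<theta>]
  have [measurable]: "\<pi> i \<in> hist_space M i \<rightarrow>\<^sub>M prob_algebra (Action M)"
    using \<pi> by (simp add: is_policy_def)
  have [measurable]: "Reward M \<in> borel_measurable (SA M)" using M by (simp add: is_mdp_family_def)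
  show ?thesis unfolding step_kernel_def by measurable
qed

lemma Ionescu_Tulcea_step_kernel:
  assumes "is_mdp_family M" "is_policy M \<pi>"
    and "\<rho> \<in> space (prob_algebra (State M))" "\<theta> \<in> space (Param M)"
  shows "Ionescu_Tulcea (step_kernel M \<rho> \<pi> \<theta>) (\<lambda>_. step_space M)"
proof (rule Ionescu_Tulcea.intro)
  show "step_kernel M \<rho> \<pi> \<theta> i \<in> PiM {0..<i} (\<lambda>_. step_space M) \<rightarrow>\<^sub>M subprob_algebra ((\<lambda>_. step_space M) i)" for i
    using measurable_prob_algebraD[OF measurable_step_kernel[OF assms]] by simp
  show "prob_space (step_kernel M \<rho> \<pi> \<theta> i x)"
    if "x \<in> space (PiM {0..<i} (\<lambda>_. step_space M))" for i x
    using measurable_space[OF measurable_step_kernel[OF assms] that] by (simp add: space_prob_algebra)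
qed

text \<open>The law of the whole trajectory under \<open>P\<^sub>\<theta>\<^sub>,\<^sub>\<pi>\<close>, on \<open>PiM UNIV (\<lambda>_. step_space M)\<close>.\<close>

definition law ::
  "('p, 's, 'a) mdp_family \<Rightarrow> 's measure \<Rightarrow> ('s, 'a) policy \<Rightarrow> 'p \<Rightarrow> ('s, 'a) trajectory measure" where
  "law M \<rho> \<pi> \<theta> =
     projective_family.lim UNIV
       (Ionescu_Tulcea.CI (step_kernel M \<rho> \<pi> \<theta>) (\<lambda>_. step_space M)) (\<lambda>_. step_space M)"

text \<open>
  The conditional law of \<open>(S\<^bsub>i+j\<^esub>, A\<^bsub>i+j\<^esub>)\<close> given that the extended history at time \<open>i\<close> equals \<open>x\<close>,
  in the version defined for every \<open>x\<close> by running the process \<open>j\<close> further steps from \<open>x\<close>.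
  Only kernels of positive index enter, so it does not depend on \<open>\<rho>\<close>.
\<close>

definition cond_law ::
  "('p, 's, 'a) mdp_family \<Rightarrow> 's measure \<Rightarrow> ('s, 'a) policy \<Rightarrow> 'p \<Rightarrow> nat \<Rightarrow> nat
    \<Rightarrow> ('s, 'a) trajectory \<Rightarrow> ('s \<times> 'a) measure" where
  "cond_law M \<rho> \<pi> \<theta> i j x =
     distr (Ionescu_Tulcea.C (step_kernel M \<rho> \<pi> \<theta>) (\<lambda>_. step_space M) (Suc i) j x)
       (SA M) (state_action (i + j))"

definition cond_density ::
  "('p, 's, 'a) mdp_family \<Rightarrow> ('s \<times> 'a) measure \<Rightarrow> 's measure \<Rightarrow> ('s, 'a) policy \<Rightarrow> 'p \<Rightarrow> nat \<Rightarrow> nat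
    \<Rightarrow> ('s, 'a) trajectory \<Rightarrow> 's \<times> 'a \<Rightarrow> ennreal" where
  "cond_density M lam \<rho> \<pi> \<theta> i j x = RN_deriv lam (cond_law M \<rho> \<pi> \<theta> i j x)"

definition possible_ext_hist :: "('p, 's, 'a) mdp_family \<Rightarrow> nat \<Rightarrow> ('s, 'a) trajectory set" where
  "possible_ext_hist M i =
     {x \<in> space (ext_hist_space M i). \<forall>i'\<le>i. snd (snd (x i')) = Reward M (state_action i' x)}"

text \<open>
  \<open>f t \<theta>\<close> is a density of \<open>H\<^sub>t\<close> under \<open>P\<^sub>\<theta>\<^sub>,\<^sub>\<pi>\<close> with respect to some sigma-finite measure \<open>\<eta> t\<close> not
  depending on \<open>\<theta>\<close>, jointly measurable so that it can be integrated against a prior. For instance,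
  when \<open>\<eta> t\<close> is built from \<open>\<rho>\<close>, the policy \<open>\<pi>\<close> and the reference measure \<open>m\<close>, the product of the
  transition densities along the history is such a density.
\<close>

definition history_density ::
  "('p, 's, 'a) mdp_family \<Rightarrow> 's measure \<Rightarrow> ('s, 'a) policy \<Rightarrow> (nat \<Rightarrow> ('s, 'a) history measure)
    \<Rightarrow> (nat \<Rightarrow> 'p \<Rightarrow> ('s, 'a) history \<Rightarrow> real) \<Rightarrow> bool" where
  "history_density M \<rho> \<pi> \<eta> f \<longleftrightarrow>
     (\<forall>t. sigma_finite_measure (\<eta> t) \<and> sets (\<eta> t) = sets (hist_space M t) \<and>
        (\<lambda>(\<theta>, h). f t \<theta> h) \<in> borel_measurable (Param M \<Otimes>\<^sub>M hist_space M t) \<and>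
        (\<forall>\<theta>\<in>space (Param M).
           (\<forall>h\<in>space (hist_space M t). 0 \<le> f t \<theta> h) \<and>
           distr (law M \<rho> \<pi> \<theta>) (hist_space M t) (hist t) = density (\<eta> t) (\<lambda>h. ennreal (f t \<theta> h))))"

text \<open>Bayes' formula, for a likelihood \<open>g \<theta> h\<close>.\<close>

definition posterior :: "'p measure \<Rightarrow> ('p \<Rightarrow> 'h \<Rightarrow> real) \<Rightarrow> 'h \<Rightarrow> 'p set \<Rightarrow> ennreal" where
  "posterior P g h B = (\<integral>\<^sup>+\<theta>\<in>B. ennreal (g \<theta> h) \<partial>P) / (\<integral>\<^sup>+\<theta>. ennreal (g \<theta> h) \<partial>P)"


section \<open>Semi-distances, covering numbers and Kullback-Leibler neighbourhoods\<close>

definition hellinger_sq :: "'s measure \<Rightarrow> ('s \<Rightarrow> real) \<Rightarrow> ('s \<Rightarrow> real) \<Rightarrow> ennreal" where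
  "hellinger_sq m p1 p2 = (\<integral>\<^sup>+x. ennreal ((sqrt (p1 x) - sqrt (p2 x))\<^sup>2) \<partial>m)"

definition esqrt :: "ennreal \<Rightarrow> ennreal" where
  "esqrt x = (if x = \<infinity> then \<infinity> else ennreal (sqrt (enn2real x)))"

text \<open>
  The semi-distance is extended-valued because the weight \<open>w\<close> (the upper bound \<open>\<nu>\<close> in particular)
  need not be integrable.
\<close>

definition semidist ::
  "('p, 's, 'a) mdp_family \<Rightarrow> ('s \<times> 'a) measure \<Rightarrow> ('s \<times> 'a \<Rightarrow> real) \<Rightarrow> 'p \<Rightarrow> 'p \<Rightarrow> ennreal" where
  "semidist M lam w \<theta> \<theta>' =
     esqrt (\<integral>\<^sup>+z. hellinger_sq (State M) (Trans M \<theta> z) (Trans M \<theta>' z) * ennreal (w z) \<partial>lam)"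

text \<open>Open balls, with centres anywhere in \<open>\<Theta>\<close>; infinite if there is no finite cover of \<open>T\<close>.\<close>

definition covering_number :: "real \<Rightarrow> 'p set \<Rightarrow> 'p set \<Rightarrow> ('p \<Rightarrow> 'p \<Rightarrow> ennreal) \<Rightarrow> enat" where
  "covering_number e \<Theta> T d =
     (INF C \<in> {C. finite C \<and> C \<subseteq> \<Theta> \<and> T \<subseteq> (\<Union>c\<in>C. {\<theta>\<in>\<Theta>. d \<theta> c < ennreal e})}. enat (card C))"

definition ln_enat :: "enat \<Rightarrow> ereal" where
  "ln_enat N = (case N of enat n \<Rightarrow> if n = 0 then -\<infinity> else ereal (ln (real n)) | \<infinity> \<Rightarrow> \<infinity>)"

definition log_ratio :: "('h \<Rightarrow> real) \<Rightarrow> ('h \<Rightarrow> real) \<Rightarrow> 'h \<Rightarrow> ereal" where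
  "log_ratio p1 p2 x = (if p2 x = 0 then \<infinity> else ereal (ln (p1 x / p2 x)))"

text \<open>
  Divergences of densities with respect to \<open>\<eta>\<close>. The two terms of \<open>KL_div\<close> are the expectations of
  the positive and the negative part of the log-ratio; for probability densities the second one is
  finite. Points with \<open>p1 x = 0\<close> do not contribute, since \<open>0 * \<infinity> = 0\<close> in \<^typ>\<open>ennreal\<close>.
\<close>

definition KL_div :: "'h measure \<Rightarrow> ('h \<Rightarrow> real) \<Rightarrow> ('h \<Rightarrow> real) \<Rightarrow> ereal" where
  "KL_div \<eta> p1 p2 =
     enn2ereal (\<integral>\<^sup>+x. ennreal (p1 x) * e2ennreal (log_ratio p1 p2 x) \<partial>\<eta>) -
     enn2ereal (\<integral>\<^sup>+x. ennreal (p1 x) * e2ennreal (- log_ratio p1 p2 x) \<partial>\<eta>)"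

definition KL_var :: "nat \<Rightarrow> 'h measure \<Rightarrow> ('h \<Rightarrow> real) \<Rightarrow> ('h \<Rightarrow> real) \<Rightarrow> ennreal" where
  "KL_var n \<eta> p1 p2 =
     (\<integral>\<^sup>+x. ennreal (p1 x) * e2ennreal \<bar>log_ratio p1 p2 x - KL_div \<eta> p1 p2\<bar> ^ n \<partial>\<eta>)"

definition KL_nbhd ::
  "'p set \<Rightarrow> 'h measure \<Rightarrow> ('p \<Rightarrow> 'h \<Rightarrow> real) \<Rightarrow> nat \<Rightarrow> 'p \<Rightarrow> real \<Rightarrow> nat \<Rightarrow> 'p set" where
  "KL_nbhd \<Theta> \<eta> g t \<theta>0 e n =
     {\<theta>\<in>\<Theta>. KL_div \<eta> (g \<theta>0) (g \<theta>) \<le> ereal (real t * e\<^sup>2) \<and>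
            KL_var n \<eta> (g \<theta>0) (g \<theta>) \<le> ennreal (real t powr (real n / 2) * e ^ n)}"


section \<open>Rates and testing constants\<close>

definition block_sum :: "nat \<Rightarrow> nat \<Rightarrow> (nat \<Rightarrow> real) \<Rightarrow> nat \<Rightarrow> real" where
  "block_sum k l \<alpha> t = (\<Sum>i<t div (k + l). \<alpha> (i * (k + l)))"

text \<open>The index \<open>(floor (t / (k + l)) - 1) (k + l)\<close>; only used for \<open>t \<ge> k + l\<close>.\<close>

definition last_block :: "nat \<Rightarrow> nat \<Rightarrow> nat \<Rightarrow> nat" where
  "last_block k l t = (t div (k + l) - 1) * (k + l)"

definition eps_bar :: "nat \<Rightarrow> nat \<Rightarrow> (nat \<Rightarrow> real) \<Rightarrow> (nat \<Rightarrow> real) \<Rightarrow> nat \<Rightarrow> real" where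
  "eps_bar k l \<alpha> \<epsilon> t = sqrt (block_sum k l \<alpha> t * (\<epsilon> t)\<^sup>2 / real t)"

definition testing_constants ::
  "('p, 's, 'a) mdp_family \<Rightarrow> ('s, 'a) policy \<Rightarrow> ('s \<times> 'a) measure \<Rightarrow> 'p \<Rightarrow> nat \<Rightarrow> nat \<Rightarrow> (nat \<Rightarrow> real)
    \<Rightarrow> ('s \<times> 'a \<Rightarrow> real) \<Rightarrow> ('s \<times> 'a \<Rightarrow> real) \<Rightarrow> real \<Rightarrow> real \<Rightarrow> bool" where
  "testing_constants M \<pi> lam \<theta>0 k l \<alpha> \<mu> \<nu> K \<xi> \<longleftrightarrow>
     0 < K \<and> 0 < \<xi> \<and> \<xi> < 1 \<and>
     (\<forall>t\<ge>k + l. \<forall>\<theta>1\<in>space (Param M).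
        \<exists>\<phi>\<in>borel_measurable (hist_space M t).
          (\<forall>h\<in>space (hist_space M t). 0 \<le> \<phi> h \<and> \<phi> h \<le> 1) \<and>
          (let bound = exp (- K * (block_sum k l \<alpha> t * (enn2real (semidist M lam \<mu> \<theta>0 \<theta>1))\<^sup>2));
               B = {\<theta>\<in>space (Param M).
                      semidist M lam \<nu> \<theta> \<theta>1
                        \<le> ennreal (\<xi> * sqrt (\<alpha> (last_block k l t))) * semidist M lam \<mu> \<theta>0 \<theta>1}
           in \<forall>\<rho>\<in>space (prob_algebra (State M)).
                (\<integral>\<omega>. \<phi> (hist t \<omega>) \<partial>law M \<rho> \<pi> \<theta>0) \<le> bound \<and>
                (\<forall>\<theta>\<in>B. (\<integral>\<omega>. 1 - \<phi> (hist t \<omega>) \<partial>law M \<rho> \<pi> \<theta>) \<le> bound)))"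

end

theory Submission
  imports Defs
begin

text \<open>
  The complement of the \<open>d\<^sub>\<mu>\<close>-ball of radius \<open>J * \<epsilon>\<^sub>t\<close> is cut into the shells
  \<open>j * \<epsilon>\<^sub>t < d\<^sub>\<mu> \<le> (j + 1) * \<epsilon>\<^sub>t\<close>. With \<open>L = t * eps_bar\<^sup>2\<close>, the entropy bound and the tests give for
  each shell a critical region whose error probabilities are of order \<open>exp (L - K * L * j\<^sup>2)\<close> under
  \<open>\<theta>\<^sub>0\<close> and \<open>exp (- K * L * j\<^sup>2)\<close> on the shell; against the prior mass ratio \<open>exp (K * L * j\<^sup>2 / 2)\<close> and
  the lower bound \<open>exp (- (1 + C) * L)\<close> for the evidence, the sum over \<open>j \<ge> J\<close> is small.

  The tests need centres inside the shell, whereas the covering balls have arbitrary centres and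
  cover a ball slightly larger than the one whose radius is the inner radius of the shell. Moving
  the centres by the triangle inequality doubles the radii, which is just too much. But \<open>d\<^sub>\<nu>\<close> is the
  distance of an \<open>L\<^sup>2\<close>-space, where four points of a ball of radius \<open>r\<close> cannot be pairwise more than
  \<open>sqrt (8 / 3) * r\<close> apart; hence three centres per ball and the radius \<open>sqrt (8 / 3) * r\<close> suffice.

  That \<open>d\<^sub>\<mu>\<close> is finite, so that the shells exhaust the complement, follows from the lower bound on
  the conditional densities, which makes \<open>\<mu>\<close> integrable.
\<close>

section \<open>The law of the process\<close>

lemma
  assumes "is_mdp_family M" "is_policy M \<pi>"
    and "\<rho> \<in> space (prob_algebra (State M))" "\<theta> \<in> space (Param M)"
  shows prob_space_law: "prob_space (law M \<rho> \<pi> \<theta>)"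
    and sets_law: "sets (law M \<rho> \<pi> \<theta>) = sets (PiM UNIV (\<lambda>_. step_space M))"
proof -
  interpret Ionescu_Tulcea "step_kernel M \<rho> \<pi> \<theta>" "\<lambda>_. step_space M"
    by (rule Ionescu_Tulcea_step_kernel[OF assms])
  show sets: "sets (law M \<rho> \<pi> \<theta>) = sets (PiM UNIV (\<lambda>_. step_space M))"
    by (simp add: law_def)
  \<comment> \<open>The marginal on the empty index set has total mass 1, and taking an image
    measure does not change the total mass.\<close>
  have "prob_space (distr (law M \<rho> \<pi> \<theta>) (PiM {} (\<lambda>_. step_space M)) (\<lambda>x. restrict x {}))"
    using distr_lim[of "{}"] PF.prob_space_P[of "{}"] by (simp add: law_def)
  then show "prob_space (law M \<rho> \<pi> \<theta>)"
    by (rule prob_space_distrD[rotated])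
       (simp add: measurable_cong_sets[OF sets refl] space_PiM)
qed

lemma measurable_hist:
  "hist t \<in> PiM UNIV (\<lambda>_. step_space M) \<rightarrow>\<^sub>M hist_space M t"
  unfolding hist_def[abs_def] by measurable

text \<open>The lower density bound is assumed along possible histories, so one of them must exist
  before anything can be deduced about \<mu>. The step space carries probability measures and hence
  has a point; the reward coordinate is set to the value that \<open>Reward M\<close>
  prescribes.\<close>

lemma possible_ext_hist_0_nonempty:
  assumes M: "is_mdp_family M" and \<pi>: "is_policy M \<pi>"
    and \<rho>: "\<rho> \<in> space (prob_algebra (State M))" and \<theta>: "\<theta> \<in> space (Param M)"
  shows "\<exists>x. x \<in> possible_ext_hist M 0"
proof -
  interpret Ionescu_Tulcea "step_kernel M \<rho> \<pi> \<theta>" "\<lambda>_. step_space M"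
    by (rule Ionescu_Tulcea_step_kernel[OF assms])
  have "space (step_space M) \<noteq> {}" by (rule non_empty)
  then obtain s a where "s \<in> space (State M)" "a \<in> space (Action M)"
    by (auto simp: space_pair_measure)
  then have "(\<lambda>i\<in>{0..<Suc 0}. (s, a, Reward M (s, a))) \<in> possible_ext_hist M 0"
    by (auto simp: possible_ext_hist_def space_PiM space_pair_measure state_action_def)
  then show ?thesis by blast
qed

text \<open>If \<open>N\<close> has a density with respect to \<open>M\<close>, both sides agree;
  otherwise \<open>RN_deriv\<close> takes its default value 0.\<close>

lemma nn_integral_RN_deriv_le:
  "(\<integral>\<^sup>+x. RN_deriv M N x \<partial>M) \<le> emeasure N (space N)"
proof (cases "\<exists>f. f \<in> borel_measurable M \<and> density M f = N")
  case True
  then obtain f where "f \<in> borel_measurable M" "density M f = N" by blast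
  then have "density M (RN_deriv M N) = N" by (metis density_RN_deriv_density)
  then have "emeasure N (space N) = emeasure (density M (RN_deriv M N)) (space M)"
    by (metis space_density)
  also have "\<dots> = (\<integral>\<^sup>+x. RN_deriv M N x \<partial>M)"
    by (auto simp: emeasure_density intro!: nn_integral_cong)
  finally show ?thesis by simp
next
  case False
  then have "RN_deriv M N = (\<lambda>_. 0)" unfolding RN_deriv_def by (rule if_not_P)
  then show ?thesis by simp
qed

text \<open>Conditional densities have integral at most 1, and so does their average over
  \<open>j\<close>. Integrating the lower bound therefore shows that \<open>a\<close> times the
  integral of \<mu> is at most 1.\<close>

lemma nn_integral_weight_finite:
  assumes M: "is_mdp_family M" and \<pi>: "is_policy M \<pi>"
    and \<rho>: "\<rho> \<in> space (prob_algebra (State M))" and \<theta>: "\<theta> \<in> space (Param M)"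
    and a: "0 < a" and k: "0 < k" and \<mu>: "\<mu> \<in> borel_measurable lam"
    and x: "x \<in> possible_ext_hist M i"
    and lower: "AE z in lam. ennreal (a * \<mu> z)
      \<le> (\<Sum>j = 1..k. cond_density M lam \<rho> \<pi> \<theta> i j x z) / of_nat k"
  shows "(\<integral>\<^sup>+z. ennreal (\<mu> z) \<partial>lam) < \<infinity>"
proof -
  interpret Ionescu_Tulcea "step_kernel M \<rho> \<pi> \<theta>" "\<lambda>_. step_space M"
    by (rule Ionescu_Tulcea_step_kernel[OF M \<pi> \<rho> \<theta>])
  have dens: "(\<integral>\<^sup>+z. cond_density M lam \<rho> \<pi> \<theta> i j x z \<partial>lam) \<le> 1" if "1 \<le> j" for j
  proof -
    have x': "x \<in> space (PiM {0..<Suc i} (\<lambda>_. step_space M))"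
      using x by (simp add: possible_ext_hist_def)
    interpret C: prob_space "C (Suc i) j x" by (rule prob_space_C[OF x'])
    have "state_action (i + j) \<in> C (Suc i) j x \<rightarrow>\<^sub>M SA M"
      unfolding measurable_cong_sets[OF sets_C[OF x'] refl]
      using that by (intro measurable_state_action) auto
    then interpret D: prob_space "cond_law M \<rho> \<pi> \<theta> i j x"
      unfolding cond_law_def by (rule C.prob_space_distr)
    show ?thesis
      unfolding cond_density_def
      using nn_integral_RN_deriv_le[of lam "cond_law M \<rho> \<pi> \<theta> i j x"] D.emeasure_space_1 by simp
  qed
  have meas: "cond_density M lam \<rho> \<pi> \<theta> i j x \<in> borel_measurable lam" for j
    unfolding cond_density_def by measurable
  note [measurable] = \<mu> meas
  have "ennreal a * (\<integral>\<^sup>+z. ennreal (\<mu> z) \<partial>lam) = (\<integral>\<^sup>+z. ennreal (a * \<mu> z) \<partial>lam)"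
    using a by (simp add: nn_integral_cmult[symmetric] ennreal_mult')
  also have "\<dots> \<le> (\<integral>\<^sup>+z. (\<Sum>j = 1..k. cond_density M lam \<rho> \<pi> \<theta> i j x z) / of_nat k \<partial>lam)"
    by (rule nn_integral_mono_AE[OF lower])
  also have "\<dots> = (\<Sum>j = 1..k. \<integral>\<^sup>+z. cond_density M lam \<rho> \<pi> \<theta> i j x z \<partial>lam) / of_nat k"
    by (simp add: nn_integral_divide nn_integral_sum)
  also have "\<dots> \<le> (\<Sum>j = 1..k. 1) / of_nat k"
    by (intro divide_right_mono_ennreal sum_mono dens) auto
  also have "\<dots> < \<infinity>"
    using k by (auto simp: ennreal_divide_eq_top_iff less_top[symmetric])
  finally have "ennreal a * (\<integral>\<^sup>+z. ennreal (\<mu> z) \<partial>lam) < \<infinity>" .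
  then show ?thesis
    using a by (auto simp: ennreal_mult_less_top)
qed

section \<open>The Hilbertian semi-distances\<close>

text \<open>The square root is kept apart because the Hilbert space inequalities below are additive
  in squared distances: these can be summed and integrated in \<open>ennreal\<close>, infinite
  values included.\<close>

definition semidist_sq ::
  "('p, 's, 'a) mdp_family \<Rightarrow> ('s \<times> 'a) measure \<Rightarrow> ('s \<times> 'a \<Rightarrow> real) \<Rightarrow> 'p \<Rightarrow> 'p \<Rightarrow> ennreal" where
  "semidist_sq M lam w \<theta> \<theta>' =
     (\<integral>\<^sup>+z. hellinger_sq (State M) (Trans M \<theta> z) (Trans M \<theta>' z) * ennreal (w z) \<partial>lam)"

lemma semidist_eq: "semidist M lam w \<theta> \<theta>' = esqrt (semidist_sq M lam w \<theta> \<theta>')"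
  by (simp add: semidist_def semidist_sq_def)

lemma semidist_sq_commute: "semidist_sq M lam w \<theta> \<theta>' = semidist_sq M lam w \<theta>' \<theta>"
  by (simp add: semidist_sq_def hellinger_sq_def power2_commute)

lemma semidist_commute: "semidist M lam w \<theta> \<theta>' = semidist M lam w \<theta>' \<theta>"
  by (simp add: semidist_eq semidist_sq_commute)

section \<open>Measurability and finiteness of the semi-distances\<close>

lemma less_esqrt_iff:
  assumes "0 \<le> s"
  shows "ennreal s < esqrt x \<longleftrightarrow> ennreal (s\<^sup>2) < x"
proof (cases x)
  case (real r)
  have "s < sqrt r \<longleftrightarrow> s\<^sup>2 < r"
    using assms real(2) by (metis abs_of_nonneg real_sqrt_abs real_sqrt_less_iff)
  then show ?thesis using assms real
    by (auto simp: esqrt_def ennreal_less_iff)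
qed (auto simp: esqrt_def)

lemma esqrt_less_iff:
  assumes "0 \<le> r"
  shows "esqrt x < ennreal r \<longleftrightarrow> x < ennreal (r\<^sup>2)"
proof (cases x)
  case (real y)
  have "sqrt y < r \<longleftrightarrow> y < r\<^sup>2"
    using assms real(2) by (metis abs_of_nonneg real_sqrt_abs real_sqrt_less_iff)
  then show ?thesis using assms real
    by (auto simp: esqrt_def ennreal_less_iff)
qed (auto simp: esqrt_def)

lemma measurable_esqrt[measurable]: "esqrt \<in> borel_measurable borel"
  unfolding esqrt_def[abs_def] by measurable

lemma measurable_Trans:
  assumes "is_mdp_family M"
  shows "(\<lambda>x. Trans M (fst x) (fst (snd x)) (snd (snd x)))
    \<in> borel_measurable (Param M \<Otimes>\<^sub>M (SA M \<Otimes>\<^sub>M State M))"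
  using assms unfolding is_mdp_family_def case_prod_unfold by blast

lemma Trans_nonneg:
  assumes "is_mdp_family M" "\<theta> \<in> space (Param M)" "z \<in> space (SA M)" "s \<in> space (State M)"
  shows "0 \<le> Trans M \<theta> z s"
  using assms by (simp add: is_mdp_family_def)

lemma measurable_Trans_section:
  assumes "is_mdp_family M" "\<theta> \<in> space (Param M)" "z \<in> space (SA M)"
  shows "Trans M \<theta> z \<in> borel_measurable (State M)"
proof -
  have "(\<lambda>s. (\<theta>, z, s)) \<in> State M \<rightarrow>\<^sub>M Param M \<Otimes>\<^sub>M (SA M \<Otimes>\<^sub>M State M)"
    using assms by measurable
  from measurable_compose[OF this measurable_Trans[OF assms(1)]] show ?thesis by simp
qed

text \<open>Joint measurability in the parameter and the state-action pair is what keeps the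
  weighted integral over the pair measurable in the parameter.\<close>

lemma measurable_hellinger_sq_pair:
  assumes M: "is_mdp_family M" and \<theta>': "\<theta>' \<in> space (Param M)"
  shows "(\<lambda>x. hellinger_sq (State M) (Trans M (fst x) (snd x)) (Trans M \<theta>' (snd x)))
    \<in> borel_measurable (Param M \<Otimes>\<^sub>M SA M)"
proof -
  interpret sigma_finite_measure "State M" using M by (simp add: is_mdp_family_def)
  let ?X = "(Param M \<Otimes>\<^sub>M SA M) \<Otimes>\<^sub>M State M"
  have "(\<lambda>y. (fst (fst y), snd (fst y), snd y)) \<in> ?X \<rightarrow>\<^sub>M Param M \<Otimes>\<^sub>M (SA M \<Otimes>\<^sub>M State M)"
    by measurable
  from measurable_compose[OF this measurable_Trans[OF M]]
  have 1[measurable]: "(\<lambda>y. Trans M (fst (fst y)) (snd (fst y)) (snd y)) \<in> borel_measurable ?X" by simp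
  have "(\<lambda>y. (\<theta>', snd (fst y), snd y)) \<in> ?X \<rightarrow>\<^sub>M Param M \<Otimes>\<^sub>M (SA M \<Otimes>\<^sub>M State M)"
    using \<theta>' by measurable
  from measurable_compose[OF this measurable_Trans[OF M]]
  have 2[measurable]: "(\<lambda>y. Trans M \<theta>' (snd (fst y)) (snd y)) \<in> borel_measurable ?X" by simp
  have "(\<lambda>(x, s). ennreal ((sqrt (Trans M (fst x) (snd x) s) - sqrt (Trans M \<theta>' (snd x) s))\<^sup>2))
    \<in> borel_measurable ?X"
    unfolding case_prod_beta by measurable
  from borel_measurable_nn_integral[OF this] show ?thesis
    unfolding hellinger_sq_def .
qed

lemma measurable_hellinger_sq:
  assumes M: "is_mdp_family M" and \<theta>: "\<theta> \<in> space (Param M)" and \<theta>': "\<theta>' \<in> space (Param M)"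
  shows "(\<lambda>z. hellinger_sq (State M) (Trans M \<theta> z) (Trans M \<theta>' z)) \<in> borel_measurable (SA M)"
  using measurable_compose[OF measurable_Pair1'[OF \<theta>] measurable_hellinger_sq_pair[OF M \<theta>']]
  by simp

text \<open>A prior has to assign mass to the shells around \<open>\<theta>0\<close>, and these are
  cut out by this function.\<close>

lemma measurable_semidist:
  assumes M: "is_mdp_family M" and lam: "finite_measure lam" "sets lam = sets (SA M)"
    and w: "w \<in> borel_measurable (SA M)" and \<theta>': "\<theta>' \<in> space (Param M)"
  shows "(\<lambda>\<theta>. semidist M lam w \<theta> \<theta>') \<in> borel_measurable (Param M)"
proof -
  interpret finite_measure lam by fact
  have cong: "sets (Param M \<Otimes>\<^sub>M lam) = sets (Param M \<Otimes>\<^sub>M SA M)"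
    using lam(2) by (rule sets_pair_measure_cong[OF refl])
  have "(\<lambda>(\<theta>, z). hellinger_sq (State M) (Trans M \<theta> z) (Trans M \<theta>' z) * ennreal (w z))
    \<in> borel_measurable (Param M \<Otimes>\<^sub>M lam)"
    unfolding measurable_cong_sets[OF cong refl] case_prod_beta
    using measurable_hellinger_sq_pair[OF M \<theta>'] w by measurable
  from borel_measurable_nn_integral[OF this] show ?thesis
    unfolding semidist_def by measurable
qed

text \<open>Expanding the square and dropping the cross term, which enters with a negative sign,
  leaves the sum of two densities of total mass 1.\<close>

lemma hellinger_sq_le:
  assumes M: "is_mdp_family M" and \<theta>: "\<theta> \<in> space (Param M)" and \<theta>': "\<theta>' \<in> space (Param M)"
    and z: "z \<in> space (SA M)"
  shows "hellinger_sq (State M) (Trans M \<theta> z) (Trans M \<theta>' z) \<le> 2"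
proof -
  note [measurable] = measurable_Trans_section[OF M \<theta> z] measurable_Trans_section[OF M \<theta>' z]
  have "hellinger_sq (State M) (Trans M \<theta> z) (Trans M \<theta>' z)
      \<le> (\<integral>\<^sup>+s. ennreal (Trans M \<theta> z s) + ennreal (Trans M \<theta>' z s) \<partial>State M)"
    unfolding hellinger_sq_def
  proof (rule nn_integral_mono)
    fix s assume s: "s \<in> space (State M)"
    have "0 \<le> Trans M \<theta> z s" "0 \<le> Trans M \<theta>' z s"
      using Trans_nonneg[OF M _ z s] \<theta> \<theta>' by auto
    then show "ennreal ((sqrt (Trans M \<theta> z s) - sqrt (Trans M \<theta>' z s))\<^sup>2)
        \<le> ennreal (Trans M \<theta> z s) + ennreal (Trans M \<theta>' z s)"
      by (simp add: ennreal_plus[symmetric] power2_diff del: ennreal_plus)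
  qed
  also have "\<dots> = 1 + 1"
    using M \<theta> \<theta>' z by (simp add: nn_integral_add is_mdp_family_def)
  finally show ?thesis by simp
qed

lemma semidist_finite:
  assumes M: "is_mdp_family M" and sets: "sets lam = sets (SA M)"
    and w: "w \<in> borel_measurable (SA M)" and fin: "(\<integral>\<^sup>+z. ennreal (w z) \<partial>lam) < \<infinity>"
    and \<theta>: "\<theta> \<in> space (Param M)" and \<theta>': "\<theta>' \<in> space (Param M)"
  shows "semidist M lam w \<theta> \<theta>' < \<infinity>"
proof -
  have "semidist_sq M lam w \<theta> \<theta>' \<le> (\<integral>\<^sup>+z. 2 * ennreal (w z) \<partial>lam)"
    unfolding semidist_sq_def
    by (intro nn_integral_mono mult_right_mono hellinger_sq_le[OF M \<theta> \<theta>'])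
       (simp_all add: sets_eq_imp_space_eq[OF sets])
  also have "\<dots> = 2 * (\<integral>\<^sup>+z. ennreal (w z) \<partial>lam)"
    using w by (intro nn_integral_cmult) (simp add: measurable_cong_sets[OF sets refl])
  also have "\<dots> < \<infinity>" using fin by (simp add: ennreal_mult_less_top)
  finally show ?thesis by (simp add: semidist_eq esqrt_def)
qed

section \<open>Separated points in a ball of a Hilbertian semi-distance\<close>

lemma sum_sq_diff_le:
  fixes x :: "'i \<Rightarrow> real"
  shows "(\<Sum>i\<in>I. \<Sum>j\<in>I. (x i - x j)\<^sup>2) \<le> 2 * real (card I) * (\<Sum>i\<in>I. (x i - c)\<^sup>2)"
proof -
  define y where "y i = x i - c" for i
  have "(\<Sum>i\<in>I. \<Sum>j\<in>I. (x i - x j)\<^sup>2) = (\<Sum>i\<in>I. \<Sum>j\<in>I. (y i)\<^sup>2 + (y j)\<^sup>2 - 2 * (y i * y j))"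
    by (simp add: y_def power2_eq_square algebra_simps)
  \<comment> \<open>Over all ordered pairs the mixed terms add up to the square of the sum of the
    \<open>y i\<close>. It enters with a negative sign and is dropped, which loses nothing when
    \<open>c\<close> is the mean of the points.\<close>
  also have "\<dots> = 2 * real (card I) * (\<Sum>i\<in>I. (y i)\<^sup>2) - 2 * (\<Sum>i\<in>I. y i)\<^sup>2"
    by (simp add: sum.distrib sum_subtractf sum_product[of y I y I] power2_eq_square
        flip: sum_distrib_left)
  also have "\<dots> \<le> 2 * real (card I) * (\<Sum>i\<in>I. (y i)\<^sup>2)" by simp
  finally show ?thesis by (simp add: y_def)
qed

text \<open>The inequality for real numbers is applied at each point \<open>s\<close> to the values
  \<open>sqrt (p i s)\<close> with centre \<open>sqrt (q s)\<close>, and then integrated.\<close>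

lemma sum_hellinger_sq_le:
  fixes p :: "'i \<Rightarrow> 's \<Rightarrow> real"
  assumes p[measurable]: "\<And>i. i \<in> I \<Longrightarrow> p i \<in> borel_measurable m"
    and q[measurable]: "q \<in> borel_measurable m"
  shows "(\<Sum>i\<in>I. \<Sum>j\<in>I. hellinger_sq m (p i) (p j))
    \<le> ennreal (2 * real (card I)) * (\<Sum>i\<in>I. hellinger_sq m (p i) q)"
proof -
  have "(\<Sum>i\<in>I. \<Sum>j\<in>I. hellinger_sq m (p i) (p j))
      = (\<integral>\<^sup>+s. (\<Sum>i\<in>I. \<Sum>j\<in>I. ennreal ((sqrt (p i s) - sqrt (p j s))\<^sup>2)) \<partial>m)"
    unfolding hellinger_sq_def
    by (subst nn_integral_sum; (intro sum.cong refl nn_integral_sum[symmetric])?; measurable)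
  also have "\<dots> \<le> (\<integral>\<^sup>+s. ennreal (2 * real (card I)) *
      (\<Sum>i\<in>I. ennreal ((sqrt (p i s) - sqrt (q s))\<^sup>2)) \<partial>m)"
    by (intro nn_integral_mono)
       (simp add: sum_ennreal sum_nonneg ennreal_mult[symmetric] ennreal_leI sum_sq_diff_le)
  also have "\<dots> = ennreal (2 * real (card I)) * (\<Sum>i\<in>I. hellinger_sq m (p i) q)"
    unfolding hellinger_sq_def
    by (subst nn_integral_cmult, measurable) (subst nn_integral_sum, measurable)
  finally show ?thesis .
qed

text \<open>A second integration, over state-action pairs with weight \<open>w\<close>. The
  semi-distance is the distance of the functions \<open>sqrt (Trans M \<theta> z s)\<close> of
  \<open>(z, s)\<close> in a weighted L2 space, and the inequality is the one valid in any Hilbert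
  space.\<close>

lemma sum_semidist_sq_le:
  assumes M: "is_mdp_family M" and sets: "sets lam = sets (SA M)"
    and w: "w \<in> borel_measurable (SA M)"
    and I: "I \<subseteq> space (Param M)" and c: "c \<in> space (Param M)"
  shows "(\<Sum>i\<in>I. \<Sum>j\<in>I. semidist_sq M lam w i j)
    \<le> ennreal (2 * real (card I)) * (\<Sum>i\<in>I. semidist_sq M lam w i c)"
proof -
  let ?h = "\<lambda>i j z. hellinger_sq (State M) (Trans M i z) (Trans M j z)"
  have m: "(\<lambda>z. ?h i j z * ennreal (w z)) \<in> borel_measurable lam"
    if "i \<in> space (Param M)" "j \<in> space (Param M)" for i j
    unfolding measurable_cong_sets[OF sets refl]
    using measurable_hellinger_sq[OF M that] w by measurable
  have "(\<Sum>i\<in>I. \<Sum>j\<in>I. semidist_sq M lam w i j)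
      = (\<integral>\<^sup>+z. (\<Sum>i\<in>I. \<Sum>j\<in>I. ?h i j z * ennreal (w z)) \<partial>lam)"
    unfolding semidist_sq_def using I m
    by (subst nn_integral_sum; (intro sum.cong refl nn_integral_sum[symmetric])?)
       (auto intro!: borel_measurable_sum simp: subset_iff)
  also have "\<dots> \<le> (\<integral>\<^sup>+z. ennreal (2 * real (card I)) * (\<Sum>i\<in>I. ?h i c z * ennreal (w z)) \<partial>lam)"
  proof (rule nn_integral_mono)
    fix z assume "z \<in> space lam"
    then have z: "z \<in> space (SA M)" by (simp add: sets_eq_imp_space_eq[OF sets])
    have "(\<Sum>i\<in>I. \<Sum>j\<in>I. ?h i j z) * ennreal (w z)
        \<le> (ennreal (2 * real (card I)) * (\<Sum>i\<in>I. ?h i c z)) * ennreal (w z)"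
      using I c by (intro mult_right_mono sum_hellinger_sq_le measurable_Trans_section[OF M _ z]) auto
    then show "(\<Sum>i\<in>I. \<Sum>j\<in>I. ?h i j z * ennreal (w z))
        \<le> ennreal (2 * real (card I)) * (\<Sum>i\<in>I. ?h i c z * ennreal (w z))"
      by (simp add: sum_distrib_right mult.assoc)
  qed
  also have "\<dots> = ennreal (2 * real (card I)) * (\<Sum>i\<in>I. semidist_sq M lam w i c)"
    unfolding semidist_sq_def using I m[OF _ c]
    by (subst nn_integral_cmult)
       (auto intro!: borel_measurable_sum nn_integral_sum arg_cong2[where f="(*)"])
  finally show ?thesis .
qed

text \<open>With \<open>m\<close> points, summing over ordered pairs bounds
  \<open>m * (m - 1) * s^2\<close> by \<open>2 * m\<close> times the sum of the squared distances to
  \<open>c\<close>. That is below \<open>2 * m^2 * r^2\<close>, hence below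
  \<open>3 / 4 * m^2 * s^2\<close>, which is impossible once \<open>m\<close> is at least 4.\<close>

lemma card_separated_in_ball:
  assumes M: "is_mdp_family M" and sets: "sets lam = sets (SA M)"
    and w: "w \<in> borel_measurable (SA M)"
    and F: "finite F" "F \<subseteq> space (Param M)" and c: "c \<in> space (Param M)"
    and ball: "\<And>x. x \<in> F \<Longrightarrow> semidist M lam w x c < ennreal r"
    and sep: "\<And>x y. x \<in> F \<Longrightarrow> y \<in> F \<Longrightarrow> x \<noteq> y \<Longrightarrow> ennreal s < semidist M lam w x y"
    and rs: "0 \<le> r" "0 \<le> s" "8 * r\<^sup>2 \<le> 3 * s\<^sup>2"
  shows "card F \<le> 3"
proof (rule ccontr)
  assume "\<not> card F \<le> 3"
  define m where "m = real (card F)"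
  have m: "4 \<le> m" using \<open>\<not> card F \<le> 3\<close> by (simp add: m_def)
  then have "F \<noteq> {}" by (auto simp: m_def)
  have D: "semidist_sq M lam w x c < ennreal (r\<^sup>2)" if "x \<in> F" for x
    using ball[OF that] rs by (simp add: semidist_eq esqrt_less_iff)
  define d where "d x = enn2real (semidist_sq M lam w x c)" for x
  have d: "semidist_sq M lam w x c = ennreal (d x)" "d x < r\<^sup>2" if "x \<in> F" for x
  proof -
    show eq: "semidist_sq M lam w x c = ennreal (d x)"
      using D[OF that] unfolding d_def by (metis ennreal_enn2real order_less_trans ennreal_less_top)
    show "d x < r\<^sup>2" using D[OF that] unfolding eq by (simp add: ennreal_less_iff d_def)
  qed
  have d_nonneg: "0 \<le> d x" for x by (simp add: d_def)
  \<comment> \<open>All ordered pairs are counted, with 0 on the diagonal.\<close>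
  have "ennreal (m * (m - 1) * s\<^sup>2) = ennreal (\<Sum>x\<in>F. \<Sum>y\<in>F. if x = y then 0 else s\<^sup>2)"
  proof -
    have "(\<Sum>y\<in>F. if x = y then 0 else s\<^sup>2) = (m - 1) * s\<^sup>2" if "x \<in> F" for x
    proof -
      have "(\<Sum>y\<in>F. if x = y then 0 else s\<^sup>2) = (\<Sum>y\<in>F - {x}. s\<^sup>2)"
        using F that by (intro sum.mono_neutral_cong_right) auto
      also have "\<dots> = (m - 1) * s\<^sup>2"
        using F that card_gt_0_iff[of F] by (auto simp: m_def of_nat_diff Suc_leI)
      finally show ?thesis .
    qed
    then show ?thesis by (simp add: m_def mult.assoc)
  qed
  also have "\<dots> = (\<Sum>x\<in>F. \<Sum>y\<in>F. ennreal (if x = y then 0 else s\<^sup>2))"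
    by (simp add: sum_ennreal sum_nonneg)
  also have "\<dots> \<le> (\<Sum>x\<in>F. \<Sum>y\<in>F. semidist_sq M lam w x y)"
    using sep rs by (intro sum_mono) (auto simp: semidist_eq less_esqrt_iff intro: less_imp_le)
  also have "\<dots> \<le> ennreal (2 * m) * (\<Sum>x\<in>F. semidist_sq M lam w x c)"
    unfolding m_def by (rule sum_semidist_sq_le[OF M sets w F(2) c])
  also have "\<dots> = ennreal (2 * m * (\<Sum>x\<in>F. d x))"
  proof -
    have "(\<Sum>x\<in>F. semidist_sq M lam w x c) = ennreal (\<Sum>x\<in>F. d x)"
      using d(1) d_nonneg by (simp cong: sum.cong)
    then show ?thesis using m by (simp add: ennreal_mult d_def sum_nonneg)
  qed
  finally have "m * (m - 1) * s\<^sup>2 \<le> 2 * m * (\<Sum>x\<in>F. d x)"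
    using m by (subst (asm) ennreal_le_iff) (auto simp: d_def intro!: mult_nonneg_nonneg sum_nonneg)
  \<comment> \<open>Strict because the ball is open and \<open>F\<close> is nonempty; the final
    contradiction rests on this strictness.\<close>
  also have "(\<Sum>x\<in>F. d x) < (\<Sum>x\<in>F. r\<^sup>2)"
    using F \<open>F \<noteq> {}\<close> d(2) by (intro sum_strict_mono) auto
  then have "2 * m * (\<Sum>x\<in>F. d x) < 2 * m * (m * r\<^sup>2)"
    using m by (simp add: m_def)
  also have "\<dots> \<le> 2 * m * (m * (3 / 8 * s\<^sup>2))"
    using m rs by (intro mult_left_mono) auto
  also have "\<dots> \<le> m * (m - 1) * s\<^sup>2"
  proof -
    \<comment> \<open>Four points enter here: \<open>3 / 4 * m\<close> is at most
      \<open>m - 1\<close> exactly from \<open>m = 4\<close> on.\<close>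
    have "m * s\<^sup>2 * (3 / 4 * m) \<le> m * s\<^sup>2 * (m - 1)"
      using m by (intro mult_left_mono) auto
    then show ?thesis by (simp add: algebra_simps)
  qed
  finally show False by simp
qed

lemma semidist_self: "semidist M lam w \<theta> \<theta> = 0"
  by (simp add: semidist_def hellinger_sq_def esqrt_def)

text \<open>Separated subsets of \<open>A\<close> have at most 3 elements, so one of largest
  cardinality exists. It is a net, since a point farther than \<open>s\<close> from all its members
  could be added. Its points lie in \<open>A\<close>, whereas the centre \<open>c\<close> may lie
  outside.\<close>

lemma net_in_ball:
  assumes M: "is_mdp_family M" and sets: "sets lam = sets (SA M)"
    and w: "w \<in> borel_measurable (SA M)"
    and A: "A \<subseteq> space (Param M)" and c: "c \<in> space (Param M)"
    and ball: "\<And>x. x \<in> A \<Longrightarrow> semidist M lam w x c < ennreal r"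
    and rs: "0 \<le> r" "0 \<le> s" "8 * r\<^sup>2 \<le> 3 * s\<^sup>2"
  shows "\<exists>F\<subseteq>A. finite F \<and> card F \<le> 3 \<and> (\<forall>a\<in>A. \<exists>x\<in>F. semidist M lam w a x \<le> ennreal s)"
proof -
  define sep where "sep F \<longleftrightarrow> finite F \<and> F \<subseteq> A \<and>
    (\<forall>x\<in>F. \<forall>y\<in>F. x \<noteq> y \<longrightarrow> ennreal s < semidist M lam w x y)" for F
  have card: "card F \<le> 3" if "sep F" for F
    using that A ball by (intro card_separated_in_ball[OF M sets w _ _ c _ _ rs]) (auto simp: sep_def)
  have "sep {}" by (simp add: sep_def)
  moreover have "\<forall>F. sep F \<longrightarrow> card F < 4" using card by force
  ultimately obtain F where F: "sep F" and max: "\<And>F'. sep F' \<Longrightarrow> card F' \<le> card F"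
    using ex_has_greatest_nat[of sep "{}" card 4] by blast
  have "\<exists>x\<in>F. semidist M lam w a x \<le> ennreal s" if "a \<in> A" for a
  proof (cases "a \<in> F")
    case True
    then show ?thesis by (intro bexI[of _ a]) (simp_all add: semidist_self)
  next
    case False
    show ?thesis
    proof (rule ccontr)
      assume "\<not> (\<exists>x\<in>F. semidist M lam w a x \<le> ennreal s)"
      then have far: "ennreal s < semidist M lam w a x" if "x \<in> F" for x
        using that by (auto simp: not_le)
      then have "sep (insert a F)"
        using F \<open>a \<in> A\<close> by (auto simp: sep_def) (metis semidist_commute far)
      from max[OF this] F False show False by (simp add: sep_def)
    qed
  qed
  then show ?thesis using F card[OF F] by (auto simp: sep_def)
qed

section \<open>From covering numbers to nets inside a prescribed set\<close>

lemma covering_number_le: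
  assumes "ln_enat (covering_number e \<Theta> T d) \<le> ereal L"
  obtains C where "finite C" "C \<subseteq> \<Theta>" "T \<subseteq> (\<Union>c\<in>C. {\<theta>\<in>\<Theta>. d \<theta> c < ennreal e})"
    "real (card C) \<le> exp L"
proof -
  define CC where "CC = {C. finite C \<and> C \<subseteq> \<Theta> \<and> T \<subseteq> (\<Union>c\<in>C. {\<theta>\<in>\<Theta>. d \<theta> c < ennreal e})}"
  have N: "covering_number e \<Theta> T d = (INF C\<in>CC. enat (card C))"
    by (simp add: covering_number_def CC_def)
  \<comment> \<open>The infimum over an empty family of covers would be infinite, and so would its
    logarithm, against the real bound \<open>L\<close>.\<close>
  have "CC \<noteq> {}"
  proof
    assume "CC = {}"
    then have "covering_number e \<Theta> T d = \<infinity>" using N by (simp add: top_enat_def)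
    then show False using assms by (simp add: ln_enat_def)
  qed
  then obtain C0 where "C0 \<in> CC" by blast
  then have "enat (card C0) \<in> (\<lambda>C. enat (card C)) ` CC" by (rule imageI)
  \<comment> \<open>The order of \<open>enat\<close> is a well-order, so an actual cover attains the
    infimum.\<close>
  then have "(INF C\<in>CC. enat (card C)) \<in> (\<lambda>C. enat (card C)) ` CC" by (rule wellorder_InfI)
  then obtain C where C: "C \<in> CC" "covering_number e \<Theta> T d = enat (card C)"
    using N by auto
  have "real (card C) \<le> exp L"
  \<comment> \<open>For the empty cover \<open>ln_enat\<close> is minus infinity and carries no
    information, but then the claim is just \<open>0 \<le> exp L\<close>.\<close>
  proof (cases "card C = 0")
    case False
    then have "ln (real (card C)) \<le> L" using assms C(2) by (simp add: ln_enat_def)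
    then show ?thesis using False by (metis exp_le_cancel_iff exp_ln of_nat_0_less_iff neq0_conv)
  qed simp
  then show thesis using C that by (auto simp: CC_def)
qed

text \<open>The part of \<open>A\<close> inside each covering ball is covered by at most three balls
  of radius \<open>s\<close> centred in that part. The price is a factor 3 in number and a factor
  \<open>sqrt (8 / 3)\<close> in radius, instead of the factor 2 given by the triangle
  inequality.\<close>

lemma net_of_covering:
  assumes M: "is_mdp_family M" and sets: "sets lam = sets (SA M)"
    and w: "w \<in> borel_measurable (SA M)"
    and A: "A \<subseteq> T" and T: "T \<subseteq> space (Param M)"
    and cov: "ln_enat (covering_number r (space (Param M)) T (semidist M lam w)) \<le> ereal L"
    and rs: "0 \<le> r" "0 \<le> s" "8 * r\<^sup>2 \<le> 3 * s\<^sup>2"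
  obtains F where "finite F" "F \<subseteq> A" "real (card F) \<le> 3 * exp L"
    "\<And>a. a \<in> A \<Longrightarrow> \<exists>x\<in>F. semidist M lam w a x \<le> ennreal s"
proof -
  obtain C where C: "finite C" "C \<subseteq> space (Param M)"
    and TC: "T \<subseteq> (\<Union>c\<in>C. {\<theta>\<in>space (Param M). semidist M lam w \<theta> c < ennreal r})"
    and card_C: "real (card C) \<le> exp L"
    by (rule covering_number_le[OF cov])
  define Q where "Q c F \<longleftrightarrow> F \<subseteq> A \<and> finite F \<and> card F \<le> 3 \<and>
    (\<forall>a\<in>A. semidist M lam w a c < ennreal r \<longrightarrow> (\<exists>x\<in>F. semidist M lam w a x \<le> ennreal s))" for c F
  have "\<exists>F. Q c F" if "c \<in> C" for c
  proof -
    have "\<exists>F\<subseteq>{a\<in>A. semidist M lam w a c < ennreal r}. finite F \<and> card F \<le> 3 \<and>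
      (\<forall>a\<in>{a\<in>A. semidist M lam w a c < ennreal r}. \<exists>x\<in>F. semidist M lam w a x \<le> ennreal s)"
      using A T C that by (intro net_in_ball[OF M sets w _ _ _ rs]) auto
    then show ?thesis unfolding Q_def by blast
  qed
  then obtain G where Q: "\<And>c. c \<in> C \<Longrightarrow> Q c (G c)" by metis
  have G: "G c \<subseteq> A" "finite (G c)" "card (G c) \<le> 3" if "c \<in> C" for c
    using Q[OF that] by (simp_all add: Q_def)
  have near: "\<exists>x\<in>G c. semidist M lam w a x \<le> ennreal s"
    if "c \<in> C" "a \<in> A" "semidist M lam w a c < ennreal r" for c a
    using Q[OF that(1)] that by (simp add: Q_def)
  show thesis
  proof (rule that[of "\<Union>c\<in>C. G c"])
    show "finite (\<Union>c\<in>C. G c)" using C G by auto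
    show "(\<Union>c\<in>C. G c) \<subseteq> A" using G(1) by blast
    have "card (\<Union>c\<in>C. G c) \<le> (\<Sum>c\<in>C. card (G c))" by (rule card_UN_le[OF C(1)])
    also have "\<dots> \<le> (\<Sum>c\<in>C. 3)" by (intro sum_mono G)
    finally have "card (\<Union>c\<in>C. G c) \<le> 3 * card C" by simp
    then have "real (card (\<Union>c\<in>C. G c)) \<le> 3 * real (card C)" by linarith
    then show "real (card (\<Union>c\<in>C. G c)) \<le> 3 * exp L" using card_C by linarith
    fix a assume a: "a \<in> A"
    then obtain c where "c \<in> C" "semidist M lam w a c < ennreal r" using A TC by blast
    then show "\<exists>x\<in>\<Union>c\<in>C. G c. semidist M lam w a x \<le> ennreal s" using near[OF _ a] by blast
  qed
qed

section \<open>Bounding the posterior\<close>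

text \<open>Markov's inequality for the \<open>n\<close>-th absolute central moment of the
  log-ratio: on the event in question the log-ratio exceeds \<open>L + u\<close>, while its mean is
  at most \<open>L\<close>.\<close>

lemma KL_deviation:
  assumes p1[measurable]: "p1 \<in> borel_measurable \<eta>" and p2[measurable]: "p2 \<in> borel_measurable \<eta>"
    and p2_nonneg: "\<And>h. h \<in> space \<eta> \<Longrightarrow> 0 \<le> p2 h"
    and KL: "KL_div \<eta> p1 p2 \<le> ereal L" and V: "KL_var n \<eta> p1 p2 \<le> ennreal V"
    and u: "0 < u"
  shows "ennreal (u ^ n) * emeasure (density \<eta> (\<lambda>h. ennreal (p1 h)))
      {h \<in> space \<eta>. p2 h < p1 h * exp (- (L + u))} \<le> ennreal V"
proof -
  let ?B = "{h \<in> space \<eta>. p2 h < p1 h * exp (- (L + u))}"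
  have "ennreal (u ^ n) * emeasure (density \<eta> (\<lambda>h. ennreal (p1 h))) ?B
      = (\<integral>\<^sup>+h. ennreal (u ^ n) * (ennreal (p1 h) * indicator ?B h) \<partial>\<eta>)"
    by (subst emeasure_density, measurable) (subst nn_integral_cmult, measurable)
  also have "\<dots> \<le> KL_var n \<eta> p1 p2"
    unfolding KL_var_def
  proof (rule nn_integral_mono)
    fix h assume h: "h \<in> space \<eta>"
    show "ennreal (u ^ n) * (ennreal (p1 h) * indicator ?B h)
        \<le> ennreal (p1 h) * e2ennreal \<bar>log_ratio p1 p2 h - KL_div \<eta> p1 p2\<bar> ^ n"
    proof (cases "h \<in> ?B")
      case True
      then have less: "p2 h < p1 h * exp (- (L + u))" by simp
      have pos: "0 < p1 h"
        using less p2_nonneg[OF h] by (metis exp_gt_zero not_less order_less_le_trans order_le_less_trans zero_less_mult_pos2)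
      have "ennreal u \<le> e2ennreal \<bar>log_ratio p1 p2 h - KL_div \<eta> p1 p2\<bar>"
      proof (cases "p2 h = 0")
        case True
        \<comment> \<open>The log-ratio is plus infinity and the divergence is not, so the deviation
          is infinite.\<close>
        then have "\<bar>log_ratio p1 p2 h - KL_div \<eta> p1 p2\<bar> = \<infinity>"
          using KL by (cases "KL_div \<eta> p1 p2") (auto simp: log_ratio_def)
        then show ?thesis by simp
      next
        case False
        then have p2: "0 < p2 h" using p2_nonneg[OF h] by simp
        have "exp (L + u) < p1 h / p2 h"
          using less p2 by (simp add: exp_minus exp_diff exp_add field_simps)
        then have ln: "L + u < ln (p1 h / p2 h)"
          using pos p2 by (metis exp_less_cancel_iff exp_ln divide_pos_pos)
        show ?thesis
        proof (cases "KL_div \<eta> p1 p2")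
          case (real k)
          then have "k \<le> L" using KL by simp
          then have "u \<le> \<bar>ln (p1 h / p2 h) - k\<bar>" using ln by simp
          then show ?thesis using real False by (simp add: log_ratio_def e2ennreal_ereal ennreal_leI)
        \<comment> \<open>A divergence of plus infinity is excluded by \<open>KL\<close>; for minus
          infinity the deviation is infinite.\<close>
        qed (use KL False in \<open>auto simp: log_ratio_def\<close>)
      qed
      then have "ennreal (u ^ n) \<le> e2ennreal \<bar>log_ratio p1 p2 h - KL_div \<eta> p1 p2\<bar> ^ n"
        using u by (simp add: ennreal_power[symmetric] power_mono)
      then show ?thesis using True by (simp add: mult.commute mult_left_mono)
    qed simp
  qed
  finally show ?thesis using V by (rule order_trans)
qed

section \<open>Bayes' formula for a fixed prior and likelihood\<close>

context
  fixes P :: "'p measure" and \<eta> :: "'h measure" and g :: "'p \<Rightarrow> 'h \<Rightarrow> real"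
  assumes P: "prob_space P" and \<eta>: "sigma_finite_measure \<eta>"
    and g: "(\<lambda>x. g (fst x) (snd x)) \<in> borel_measurable (P \<Otimes>\<^sub>M \<eta>)"
begin

interpretation Pr: prob_space P by (rule P)
interpretation \<eta>: sigma_finite_measure \<eta> by (rule \<eta>)
interpretation pair_sigma_finite P \<eta> ..

lemma measurable_likelihood:
  assumes "\<theta> \<in> space P"
  shows "g \<theta> \<in> borel_measurable \<eta>"
  using measurable_compose[OF measurable_Pair1'[OF assms] g] by simp

lemma measurable_evidence:
  assumes [measurable]: "A \<in> sets P"
  shows "(\<lambda>h. \<integral>\<^sup>+\<theta>\<in>A. ennreal (g \<theta> h) \<partial>P) \<in> borel_measurable \<eta>"
proof -
  note [measurable] = g
  have "(\<lambda>x. g (snd x) (fst x)) \<in> borel_measurable (\<eta> \<Otimes>\<^sub>M P)"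
    using measurable_compose[OF measurable_pair_swap' g] by (simp add: case_prod_beta)
  note [measurable] = this
  have "(\<lambda>(h, \<theta>). ennreal (g \<theta> h) * indicator A \<theta>) \<in> borel_measurable (\<eta> \<Otimes>\<^sub>M P)"
    unfolding case_prod_beta by measurable
  from Pr.borel_measurable_nn_integral[OF this] show ?thesis .
qed

lemma measurable_total_evidence: "(\<lambda>h. \<integral>\<^sup>+\<theta>. ennreal (g \<theta> h) \<partial>P) \<in> borel_measurable \<eta>"
  using measurable_evidence[OF sets.top] unfolding nn_set_integral_space .

lemma measurable_posterior:
  assumes "A \<in> sets P"
  shows "(\<lambda>h. posterior P g h A) \<in> borel_measurable \<eta>"
  unfolding posterior_def
  by (intro borel_measurable_divide_ennreal measurable_evidence[OF assms] measurable_total_evidence)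

text \<open>Call a parameter of \<open>B\<close> bad at \<open>h\<close> if its likelihood there is
  below \<open>c\<close> times that of \<open>\<theta>0\<close>. By Fubini the mean prior mass of
  bad parameters is at most \<open>\<kappa>\<close> times that of \<open>B\<close>, so by Markov's
  inequality it reaches half of \<open>B\<close> on a set of measure at most
  \<open>2 * \<kappa>\<close>. Elsewhere the good parameters alone keep the evidence above the
  threshold.\<close>

lemma evidence_lower_bound:
  assumes \<theta>0: "\<theta>0 \<in> space P" and B: "B \<in> sets P" "0 < emeasure P B"
    and bad: "\<And>\<theta>. \<theta> \<in> B \<Longrightarrow>
      emeasure (density \<eta> (\<lambda>h. ennreal (g \<theta>0 h))) {h \<in> space \<eta>. g \<theta> h < g \<theta>0 h * c} \<le> \<kappa>"
  shows "emeasure (density \<eta> (\<lambda>h. ennreal (g \<theta>0 h)))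
    {h \<in> space \<eta>. (\<integral>\<^sup>+\<theta>. ennreal (g \<theta> h) \<partial>P) < ennreal (measure P B / 2 * (g \<theta>0 h * c))} \<le> 2 * \<kappa>"
proof -
  define b where "b = measure P B"
  have b: "emeasure P B = ennreal b" "0 < b"
    using B(2) by (auto simp: b_def Pr.emeasure_eq_measure)
  let ?Q = "density \<eta> (\<lambda>h. ennreal (g \<theta>0 h))"
  note [measurable] = g B(1) measurable_likelihood[OF \<theta>0]
  have BP: "B \<subseteq> space P" using B(1) by (rule sets.sets_into_space)
  define bd where "bd = {x \<in> space (P \<Otimes>\<^sub>M \<eta>). fst x \<in> B \<and> g (fst x) (snd x) < g \<theta>0 (snd x) * c}"
  have bd[measurable]: "bd \<in> sets (P \<Otimes>\<^sub>M \<eta>)" unfolding bd_def by measurable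
  \<comment> \<open>\<open>W h\<close> is the prior mass of the parameters that are bad at
    \<open>h\<close>.\<close>
  define W where "W h = (\<integral>\<^sup>+\<theta>. indicator bd (\<theta>, h) \<partial>P)" for h
  have W_eq: "W h = emeasure P {\<theta> \<in> B. g \<theta> h < g \<theta>0 h * c}" if "h \<in> space \<eta>" for h
  proof -
    have [measurable]: "(\<lambda>\<theta>. g \<theta> h) \<in> borel_measurable P"
      using measurable_compose[OF measurable_Pair2'[OF that] g] by simp
    have "{\<theta> \<in> B. g \<theta> h < g \<theta>0 h * c} = {\<theta> \<in> space P. \<theta> \<in> B \<and> g \<theta> h < g \<theta>0 h * c}"
      using BP by auto
    then have m: "{\<theta> \<in> B. g \<theta> h < g \<theta>0 h * c} \<in> sets P" by simp
    have "W h = (\<integral>\<^sup>+\<theta>. indicator {\<theta> \<in> B. g \<theta> h < g \<theta>0 h * c} \<theta> \<partial>P)"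
      unfolding W_def using that BP
      by (intro nn_integral_cong) (auto simp: bd_def space_pair_measure indicator_def)
    then show ?thesis using m by simp
  qed
  have W_meas[measurable]: "W \<in> borel_measurable \<eta>"
  proof -
    have "(\<lambda>(h, \<theta>). indicator bd (\<theta>, h) :: ennreal) \<in> borel_measurable (\<eta> \<Otimes>\<^sub>M P)"
      unfolding case_prod_beta by measurable
    from Pr.borel_measurable_nn_integral[OF this] show ?thesis unfolding W_def .
  qed
  have "(\<integral>\<^sup>+h. W h \<partial>?Q) = (\<integral>\<^sup>+h. ennreal (g \<theta>0 h) * W h \<partial>\<eta>)"
    by (rule nn_integral_density) measurable
  also have "\<dots> = (\<integral>\<^sup>+h. \<integral>\<^sup>+\<theta>. ennreal (g \<theta>0 h) * indicator bd (\<theta>, h) \<partial>P \<partial>\<eta>)"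
  proof (rule nn_integral_cong)
    fix h assume [measurable]: "h \<in> space \<eta>"
    have "(\<lambda>\<theta>. indicator bd (\<theta>, h) :: ennreal) \<in> borel_measurable P" by measurable
    then show "ennreal (g \<theta>0 h) * W h = (\<integral>\<^sup>+\<theta>. ennreal (g \<theta>0 h) * indicator bd (\<theta>, h) \<partial>P)"
      unfolding W_def by (simp add: nn_integral_cmult)
  qed
  also have "\<dots> = (\<integral>\<^sup>+\<theta>. \<integral>\<^sup>+h. ennreal (g \<theta>0 h) * indicator bd (\<theta>, h) \<partial>\<eta> \<partial>P)"
    by (rule Fubini') (measurable)
  also have "\<dots> \<le> (\<integral>\<^sup>+\<theta>. \<kappa> * indicator B \<theta> \<partial>P)"
  proof (rule nn_integral_mono)
    fix \<theta> assume \<theta>: "\<theta> \<in> space P"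
    note [measurable] = measurable_likelihood[OF \<theta>]
    have "(\<integral>\<^sup>+h. ennreal (g \<theta>0 h) * indicator bd (\<theta>, h) \<partial>\<eta>) = (\<integral>\<^sup>+h. ennreal (g \<theta>0 h) *
        indicator {h \<in> space \<eta>. g \<theta> h < g \<theta>0 h * c} h * indicator B \<theta> \<partial>\<eta>)"
      using \<theta> by (intro nn_integral_cong) (auto simp: bd_def space_pair_measure indicator_def)
    also have "\<dots> = emeasure ?Q {h \<in> space \<eta>. g \<theta> h < g \<theta>0 h * c} * indicator B \<theta>"
      by (subst emeasure_density, measurable) (subst nn_integral_multc, measurable)
    also have "\<dots> \<le> \<kappa> * indicator B \<theta>"
      using bad[of \<theta>] by (auto simp: indicator_def)
    finally show "(\<integral>\<^sup>+h. ennreal (g \<theta>0 h) * indicator bd (\<theta>, h) \<partial>\<eta>) \<le> \<kappa> * indicator B \<theta>" .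
  qed
  also have "\<dots> = \<kappa> * ennreal b" using b by (simp add: nn_integral_cmult_indicator)
  finally have intW: "(\<integral>\<^sup>+h. W h \<partial>?Q) \<le> \<kappa> * ennreal b" .
  \<comment> \<open>Small evidence forces the bad parameters to take up at least half of
    \<open>b\<close>.\<close>
  have "{h \<in> space \<eta>. (\<integral>\<^sup>+\<theta>. ennreal (g \<theta> h) \<partial>P) < ennreal (b / 2 * (g \<theta>0 h * c))}
    \<subseteq> {h \<in> space \<eta>. 1 \<le> ennreal (2 / b) * W h}"
  proof safe
    fix h assume h: "h \<in> space \<eta>"
      and small: "(\<integral>\<^sup>+\<theta>. ennreal (g \<theta> h) \<partial>P) < ennreal (b / 2 * (g \<theta>0 h * c))"
    \<comment> \<open>\<open>G\<close> is the good part of \<open>B\<close>: the evidence is at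
      least \<open>g \<theta>0 h * c\<close> times its prior mass.\<close>
    define G where "G = {\<theta> \<in> space P. \<theta> \<in> B \<and> \<not> g \<theta> h < g \<theta>0 h * c}"
    have [measurable]: "(\<lambda>\<theta>. g \<theta> h) \<in> borel_measurable P"
      using measurable_compose[OF measurable_Pair2'[OF h] g] by simp
    have G: "G \<in> sets P" unfolding G_def by measurable
    have "{\<theta> \<in> B. g \<theta> h < g \<theta>0 h * c} = B - G" using BP by (auto simp: G_def)
    then have Wh: "W h = ennreal (b - measure P G)"
      using W_eq[OF h] G B(1) by (simp add: Pr.emeasure_eq_measure Pr.finite_measure_Diff G_def b_def subset_iff)
    \<comment> \<open>Evidence is nonnegative, so a threshold above it is positive. This yields the
      positive factor \<open>g \<theta>0 h * c\<close> that is cancelled below.\<close>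
    have pos: "0 < b / 2 * (g \<theta>0 h * c)"
      using small by (metis ennreal_less_zero_iff ennreal_neg leI not_less_zero)
    then have gc: "0 < g \<theta>0 h * c" using b(2) by (simp add: zero_less_mult_iff)
    have "ennreal (g \<theta>0 h * c) * emeasure P G = (\<integral>\<^sup>+\<theta>. ennreal (g \<theta>0 h * c) * indicator G \<theta> \<partial>P)"
      using G by (simp add: nn_integral_cmult_indicator)
    also have "\<dots> \<le> (\<integral>\<^sup>+\<theta>. ennreal (g \<theta> h) \<partial>P)"
      by (intro nn_integral_mono) (auto simp: G_def indicator_def intro: ennreal_leI)
    also note small
    finally have "g \<theta>0 h * c * measure P G < b / 2 * (g \<theta>0 h * c)"
      using gc by (simp add: Pr.emeasure_eq_measure ennreal_mult[symmetric] ennreal_less_iff)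
    then have "g \<theta>0 h * c * measure P G < g \<theta>0 h * c * (b / 2)" by (simp add: mult.commute)
    then have "measure P G < b / 2" using gc by (metis mult_less_cancel_left_pos)
    then have "1 \<le> 2 / b * (b - measure P G)" using b(2) by (simp add: field_simps)
    then show "1 \<le> ennreal (2 / b) * W h"
      unfolding Wh using b(2) \<open>measure P G < b / 2\<close>
      by (simp add: ennreal_mult[symmetric] ennreal_leI flip: ennreal_1)
  qed
  then have "emeasure ?Q {h \<in> space \<eta>. (\<integral>\<^sup>+\<theta>. ennreal (g \<theta> h) \<partial>P) < ennreal (b / 2 * (g \<theta>0 h * c))}
      \<le> emeasure ?Q {h \<in> space ?Q. 1 \<le> ennreal (2 / b) * W h}"
    by (intro emeasure_mono) (auto, measurable)
  also have "\<dots> \<le> ennreal (2 / b) * (\<integral>\<^sup>+h\<in>space ?Q. W h \<partial>?Q)"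
    by (rule nn_integral_Markov_inequality) measurable
  also have "(\<integral>\<^sup>+h\<in>space ?Q. W h \<partial>?Q) = (\<integral>\<^sup>+h. W h \<partial>?Q)"
    by (rule nn_set_integral_space)
  also have "ennreal (2 / b) * (\<integral>\<^sup>+h. W h \<partial>?Q) \<le> ennreal (2 / b) * (\<kappa> * ennreal b)"
    by (intro mult_left_mono intW) simp
  also have "\<dots> = (ennreal (2 / b) * ennreal b) * \<kappa>" by (simp add: mult_ac)
  also have "ennreal (2 / b) * ennreal b = 2" using b(2) by (simp add: ennreal_mult[symmetric])
  finally show ?thesis unfolding b_def .
qed

text \<open>Outside \<open>T\<close> and outside the small-evidence event, posterior mass above
  \<delta> makes the numerator at least \<open>\<delta> * w * g \<theta>0 h\<close>. On this
  remaining event the density at \<open>\<theta>0\<close> is dominated by a multiple of the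
  numerator, and Fubini turns the integral of the latter into type II errors of \<open>T\<close>
  averaged over \<open>A\<close>.\<close>

lemma posterior_tail_bound:
  assumes \<theta>0: "\<theta>0 \<in> space P" and T[measurable]: "T \<in> sets \<eta>" and A[measurable]: "A \<in> sets P"
    and pos: "0 < \<delta>" "0 < w"
  shows "emeasure (density \<eta> (\<lambda>h. ennreal (g \<theta>0 h))) {h \<in> space \<eta>. ennreal \<delta> < posterior P g h A}
    \<le> emeasure (density \<eta> (\<lambda>h. ennreal (g \<theta>0 h))) T
    + emeasure (density \<eta> (\<lambda>h. ennreal (g \<theta>0 h)))
        {h \<in> space \<eta>. (\<integral>\<^sup>+\<theta>. ennreal (g \<theta> h) \<partial>P) < ennreal (w * g \<theta>0 h)}
    + ennreal (1 / (\<delta> * w)) *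
      (\<integral>\<^sup>+\<theta>\<in>A. emeasure (density \<eta> (\<lambda>h. ennreal (g \<theta> h))) (space \<eta> - T) \<partial>P)"
proof -
  let ?Q = "density \<eta> (\<lambda>h. ennreal (g \<theta>0 h))"
  let ?N = "\<lambda>h. \<integral>\<^sup>+\<theta>\<in>A. ennreal (g \<theta> h) \<partial>P" and ?D = "\<lambda>h. \<integral>\<^sup>+\<theta>. ennreal (g \<theta> h) \<partial>P"
  note [measurable] = g measurable_likelihood[OF \<theta>0] measurable_evidence[OF A]
    measurable_total_evidence
  let ?E2 = "{h \<in> space \<eta>. ?D h < ennreal (w * g \<theta>0 h)}"
  let ?E3 = "{h \<in> space \<eta> - T. ennreal (\<delta> * w) * ennreal (g \<theta>0 h) \<le> ?N h}"
  have E2: "?E2 \<in> sets \<eta>" by measurable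
  have E3[measurable]: "?E3 \<in> sets \<eta>"
  proof -
    have "?E3 = {h \<in> space \<eta>. h \<notin> T \<and> ennreal (\<delta> * w) * ennreal (g \<theta>0 h) \<le> ?N h}" by auto
    also have "\<dots> \<in> sets \<eta>" by measurable
    finally show ?thesis .
  qed
  have "{h \<in> space \<eta>. ennreal \<delta> < posterior P g h A} \<subseteq> (T \<union> ?E2) \<union> ?E3"
  proof safe
    fix h assume h: "h \<in> space \<eta>" "ennreal \<delta> < posterior P g h A" "h \<notin> T"
      and nE3: "\<not> ennreal (\<delta> * w) * ennreal (g \<theta>0 h) \<le> ?N h"
    show "?D h < ennreal (w * g \<theta>0 h)"
    proof (rule ccontr)
      assume "\<not> ?D h < ennreal (w * g \<theta>0 h)"
      then have "ennreal (\<delta> * w) * ennreal (g \<theta>0 h) \<le> ennreal \<delta> * ?D h"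
        using pos by (simp add: ennreal_mult' mult.assoc mult_left_mono not_less)
      also have "\<dots> \<le> ?N h"
      \<comment> \<open>For zero evidence the left side vanishes; for infinite evidence the quotient
        is 0 in \<open>ennreal\<close>, against the assumption on the posterior. Only between these
        values is the quotient multiplied out.\<close>
      proof (cases "?D h = 0 \<or> ?D h = \<infinity>")
        case True
        then show ?thesis
        proof
          assume "?D h = \<infinity>"
          then have "posterior P g h A = 0" by (simp add: posterior_def)
          then show ?thesis using h by simp
        qed simp
      next
        case False
        then have "ennreal \<delta> * ?D h \<le> ?N h / ?D h * ?D h"
          using h(2) by (intro mult_right_mono) (auto simp: posterior_def)
        also have "\<dots> = ?N h" using False by (simp add: ennreal_divide_times ennreal_divide_self less_top)
        finally show ?thesis .
      qed
      finally show False using nE3 by simp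
    qed
  qed
  then have "emeasure ?Q {h \<in> space \<eta>. ennreal \<delta> < posterior P g h A} \<le> emeasure ?Q ((T \<union> ?E2) \<union> ?E3)"
    using T E2 E3 by (intro emeasure_mono) auto
  also have "\<dots> \<le> emeasure ?Q (T \<union> ?E2) + emeasure ?Q ?E3"
    using T E2 E3 by (intro emeasure_subadditive) auto
  also have "\<dots> \<le> (emeasure ?Q T + emeasure ?Q ?E2) + emeasure ?Q ?E3"
    using T E2 by (intro add_right_mono emeasure_subadditive) auto
  also have "emeasure ?Q ?E3 \<le> ennreal (1 / (\<delta> * w)) *
      (\<integral>\<^sup>+\<theta>\<in>A. emeasure (density \<eta> (\<lambda>h. ennreal (g \<theta> h))) (space \<eta> - T) \<partial>P)"
  proof -
    have "emeasure ?Q ?E3 = (\<integral>\<^sup>+h. ennreal (g \<theta>0 h) * indicator ?E3 h \<partial>\<eta>)"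
      by (rule emeasure_density) measurable
    also have "\<dots> \<le> (\<integral>\<^sup>+h. ennreal (1 / (\<delta> * w)) * (?N h * indicator (space \<eta> - T) h) \<partial>\<eta>)"
    proof (rule nn_integral_mono)
      fix h
      show "ennreal (g \<theta>0 h) * indicator ?E3 h
          \<le> ennreal (1 / (\<delta> * w)) * (?N h * indicator (space \<eta> - T) h)"
      proof (cases "h \<in> ?E3")
        case True
        have "ennreal (g \<theta>0 h) = ennreal (1 / (\<delta> * w)) * (ennreal (\<delta> * w) * ennreal (g \<theta>0 h))"
          using pos by (simp add: ennreal_mult'[symmetric])
        also have "\<dots> \<le> ennreal (1 / (\<delta> * w)) * ?N h"
          using True by (intro mult_left_mono) auto
        finally show ?thesis using True by simp
      qed simp
    qed
    also have "\<dots> = ennreal (1 / (\<delta> * w)) * (\<integral>\<^sup>+h. ?N h * indicator (space \<eta> - T) h \<partial>\<eta>)"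
      by (rule nn_integral_cmult) measurable
    also have "(\<integral>\<^sup>+h. ?N h * indicator (space \<eta> - T) h \<partial>\<eta>)
        = (\<integral>\<^sup>+h. \<integral>\<^sup>+\<theta>. ennreal (g \<theta> h) * indicator A \<theta> * indicator (space \<eta> - T) h \<partial>P \<partial>\<eta>)"
    proof (rule nn_integral_cong)
      fix h assume h: "h \<in> space \<eta>"
      have [measurable]: "(\<lambda>\<theta>. g \<theta> h) \<in> borel_measurable P"
        using measurable_compose[OF measurable_Pair2'[OF h] g] by simp
      show "?N h * indicator (space \<eta> - T) h
          = (\<integral>\<^sup>+\<theta>. ennreal (g \<theta> h) * indicator A \<theta> * indicator (space \<eta> - T) h \<partial>P)"
        by (rule nn_integral_multc[symmetric]) measurable
    qed
    also have "\<dots> = (\<integral>\<^sup>+\<theta>. \<integral>\<^sup>+h. ennreal (g \<theta> h) * indicator A \<theta> * indicator (space \<eta> - T) h \<partial>\<eta> \<partial>P)"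
      by (rule Fubini') (unfold case_prod_beta, measurable)
    also have "\<dots> = (\<integral>\<^sup>+\<theta>\<in>A. emeasure (density \<eta> (\<lambda>h. ennreal (g \<theta> h))) (space \<eta> - T) \<partial>P)"
    proof (rule nn_integral_cong)
      fix \<theta> assume \<theta>: "\<theta> \<in> space P"
      note [measurable] = measurable_likelihood[OF \<theta>]
      have "(\<integral>\<^sup>+h. ennreal (g \<theta> h) * indicator A \<theta> * indicator (space \<eta> - T) h \<partial>\<eta>)
          = (\<integral>\<^sup>+h. ennreal (g \<theta> h) * indicator (space \<eta> - T) h * indicator A \<theta> \<partial>\<eta>)"
        by (simp add: mult_ac)
      also have "\<dots> = emeasure (density \<eta> (\<lambda>h. ennreal (g \<theta> h))) (space \<eta> - T) * indicator A \<theta>"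
        by (subst emeasure_density, measurable) (subst nn_integral_multc, measurable)
      finally show "(\<integral>\<^sup>+h. ennreal (g \<theta> h) * indicator A \<theta> * indicator (space \<eta> - T) h \<partial>\<eta>)
          = emeasure (density \<eta> (\<lambda>h. ennreal (g \<theta> h))) (space \<eta> - T) * indicator A \<theta>" .
    qed
    finally show ?thesis .
  qed
  finally show ?thesis by (simp add: add_left_mono)
qed

text \<open>Parameter sets and critical regions are united over all pieces. Null errors add up by
  subadditivity, whereas for a parameter in \<open>S i\<close> the single region \<open>T i\<close>
  suffices. The prior mass of \<open>B\<close> in the evidence bound cancels against the one in
  \<open>mass\<close>.\<close>

lemma posterior_peeling_bound:
  fixes S :: "nat \<Rightarrow> 'p set" and T :: "nat \<Rightarrow> 'h set" and a r m :: "nat \<Rightarrow> real"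
  assumes \<theta>0: "\<theta>0 \<in> space P" and B: "B \<in> sets P" "0 < emeasure P B"
    and c: "0 < c" and \<delta>: "0 < \<delta>"
    and evidence: "\<And>\<theta>. \<theta> \<in> B \<Longrightarrow>
      emeasure (density \<eta> (\<lambda>h. ennreal (g \<theta>0 h))) {h \<in> space \<eta>. g \<theta> h < g \<theta>0 h * c} \<le> \<kappa>"
    and S: "\<And>i. S i \<in> sets P" and T: "\<And>i. T i \<in> sets \<eta>"
    and T_null: "\<And>i. emeasure (density \<eta> (\<lambda>h. ennreal (g \<theta>0 h))) (T i) \<le> ennreal (a i)"
    and T_alt: "\<And>i \<theta>. \<theta> \<in> S i \<Longrightarrow>
      emeasure (density \<eta> (\<lambda>h. ennreal (g \<theta> h))) (space \<eta> - T i) \<le> ennreal (r i)"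
    and mass: "\<And>i. emeasure P (S i) \<le> ennreal (m i) * emeasure P B"
    and nonneg: "\<And>i. 0 \<le> r i" "\<And>i. 0 \<le> m i"
  shows "emeasure (density \<eta> (\<lambda>h. ennreal (g \<theta>0 h)))
      {h \<in> space \<eta>. ennreal \<delta> < posterior P g h (\<Union>i. S i)}
    \<le> (\<Sum>i. ennreal (a i)) + 2 * \<kappa> + ennreal (2 / (\<delta> * c)) * (\<Sum>i. ennreal (r i * m i))"
proof -
  let ?Q = "\<lambda>\<theta>. density \<eta> (\<lambda>h. ennreal (g \<theta> h))"
  define b where "b = measure P B"
  have b: "emeasure P B = ennreal b" "0 < b"
    using B(2) by (auto simp: b_def Pr.emeasure_eq_measure)
  \<comment> \<open>The level at which the lower bound for the evidence applies.\<close>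
  define w where "w = b / 2 * c"
  have w: "0 < w" using b c by (simp add: w_def)
  have "emeasure (?Q \<theta>0) {h \<in> space \<eta>. ennreal \<delta> < posterior P g h (\<Union>i. S i)}
    \<le> emeasure (?Q \<theta>0) (\<Union>i. T i)
    + emeasure (?Q \<theta>0) {h \<in> space \<eta>. (\<integral>\<^sup>+\<theta>. ennreal (g \<theta> h) \<partial>P) < ennreal (w * g \<theta>0 h)}
    + ennreal (1 / (\<delta> * w)) * (\<integral>\<^sup>+\<theta>\<in>(\<Union>i. S i). emeasure (?Q \<theta>) (space \<eta> - (\<Union>i. T i)) \<partial>P)"
    using S T by (intro posterior_tail_bound[OF \<theta>0 _ _ \<delta> w]) auto
  also have "\<dots> \<le> (\<Sum>i. ennreal (a i)) + 2 * \<kappa> + ennreal (2 / (\<delta> * c)) * (\<Sum>i. ennreal (r i * m i))"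
  proof (intro add_mono)
    have "emeasure (?Q \<theta>0) (\<Union>i. T i) \<le> (\<Sum>i. emeasure (?Q \<theta>0) (T i))"
      using T by (intro emeasure_subadditive_countably) auto
    also have "\<dots> \<le> (\<Sum>i. ennreal (a i))" by (intro suminf_le T_null) auto
    finally show "emeasure (?Q \<theta>0) (\<Union>i. T i) \<le> (\<Sum>i. ennreal (a i))" .
    have eq: "w * g \<theta>0 h = measure P B / 2 * (g \<theta>0 h * c)" for h by (simp add: w_def b_def)
    show "emeasure (?Q \<theta>0) {h \<in> space \<eta>. (\<integral>\<^sup>+\<theta>. ennreal (g \<theta> h) \<partial>P) < ennreal (w * g \<theta>0 h)} \<le> 2 * \<kappa>"
      unfolding eq by (rule evidence_lower_bound[OF \<theta>0 B evidence])
    have "(\<integral>\<^sup>+\<theta>\<in>(\<Union>i. S i). emeasure (?Q \<theta>) (space \<eta> - (\<Union>i. T i)) \<partial>P)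
        \<le> (\<integral>\<^sup>+\<theta>. (\<Sum>i. ennreal (r i) * indicator (S i) \<theta>) \<partial>P)"
    proof (rule nn_integral_mono)
      fix \<theta>
      show "emeasure (?Q \<theta>) (space \<eta> - (\<Union>i. T i)) * indicator (\<Union>i. S i) \<theta>
          \<le> (\<Sum>i. ennreal (r i) * indicator (S i) \<theta>)"
      proof (cases "\<theta> \<in> (\<Union>i. S i)")
        case True
        then obtain i where i: "\<theta> \<in> S i" by blast
        \<comment> \<open>One piece containing \<theta> is enough; the sum over all pieces then
          dominates its contribution.\<close>
        have "emeasure (?Q \<theta>) (space \<eta> - (\<Union>i. T i)) \<le> emeasure (?Q \<theta>) (space \<eta> - T i)"
          using T by (intro emeasure_mono) auto
        also have "\<dots> \<le> ennreal (r i) * indicator (S i) \<theta>" using T_alt[OF i] i by simp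
        also have "\<dots> \<le> (\<Sum>i. ennreal (r i) * indicator (S i) \<theta>)"
        proof -
          define v where "v = (\<lambda>i. ennreal (r i) * indicator (S i) \<theta>)"
          have "v i \<le> suminf v" using sum_le_suminf[of v "{i}"] by simp
          then show ?thesis unfolding v_def .
        qed
        finally show ?thesis using True by simp
      qed simp
    qed
    also have "\<dots> = (\<Sum>i. ennreal (r i) * emeasure P (S i))"
      using S by (subst nn_integral_suminf) (auto simp: nn_integral_cmult_indicator)
    also have "\<dots> \<le> (\<Sum>i. ennreal b * ennreal (r i * m i))"
    proof (intro suminf_le)
      fix i
      have "ennreal (r i) * emeasure P (S i) \<le> ennreal (r i) * (ennreal (m i) * ennreal b)"
        using mass[of i] b by (intro mult_left_mono) auto
      then show "ennreal (r i) * emeasure P (S i) \<le> ennreal b * ennreal (r i * m i)"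
        using nonneg[of i] by (simp add: ennreal_mult mult_ac)
    qed auto
    also have "\<dots> = ennreal b * (\<Sum>i. ennreal (r i * m i))" by (rule ennreal_suminf_cmult)
    finally have "ennreal (1 / (\<delta> * w)) *
        (\<integral>\<^sup>+\<theta>\<in>(\<Union>i. S i). emeasure (?Q \<theta>) (space \<eta> - (\<Union>i. T i)) \<partial>P)
      \<le> ennreal (1 / (\<delta> * w)) * (ennreal b * (\<Sum>i. ennreal (r i * m i)))"
      by (intro mult_left_mono) auto
    also have "\<dots> = ennreal (1 / (\<delta> * w) * b) * (\<Sum>i. ennreal (r i * m i))"
      by (subst ennreal_mult) (use b w \<delta> in \<open>auto simp: mult.assoc\<close>)
    also have "1 / (\<delta> * w) * b = 2 / (\<delta> * c)"
      using b c \<delta> by (simp add: w_def)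
    finally show "ennreal (1 / (\<delta> * w)) *
        (\<integral>\<^sup>+\<theta>\<in>(\<Union>i. S i). emeasure (?Q \<theta>) (space \<eta> - (\<Union>i. T i)) \<partial>P)
      \<le> ennreal (2 / (\<delta> * c)) * (\<Sum>i. ennreal (r i * m i))" .
  qed
  finally show ?thesis .
qed

end

section \<open>Tests for shells\<close>

text \<open>Turns a randomised test into a critical region: by Markov's inequality, thresholding at
  1/2 at most doubles the error bound. It is applied both to a test and to 1 minus the test.\<close>

lemma emeasure_half_test:
  assumes L: "prob_space L" and X: "X \<in> L \<rightarrow>\<^sub>M N" and \<psi>: "\<psi> \<in> borel_measurable N"
    and bnd: "\<And>h. h \<in> space N \<Longrightarrow> 0 \<le> \<psi> h \<and> \<psi> h \<le> (1::real)"
    and le: "(\<integral>\<omega>. \<psi> (X \<omega>) \<partial>L) \<le> \<beta>"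
  shows "emeasure (distr L N X) {h \<in> space N. 1 / 2 \<le> \<psi> h} \<le> ennreal (2 * \<beta>)"
proof -
  interpret prob_space L by fact
  note [measurable] = X \<psi>
  have XN: "X \<omega> \<in> space N" if "\<omega> \<in> space L" for \<omega> using measurable_space[OF X that] .
  have int: "integrable L (\<lambda>\<omega>. \<psi> (X \<omega>))"
    using bnd XN by (intro integrable_const_bound[of _ 1]) (auto intro!: AE_I2)
  have "emeasure (distr L N X) {h \<in> space N. 1 / 2 \<le> \<psi> h} = emeasure L (X -` {h \<in> space N. 1 / 2 \<le> \<psi> h} \<inter> space L)"
    by (rule emeasure_distr) measurable
  also have "X -` {h \<in> space N. 1 / 2 \<le> \<psi> h} \<inter> space L = {\<omega> \<in> space L. 1 / 2 \<le> \<psi> (X \<omega>)}"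
    using XN by auto
  also have "emeasure L \<dots> \<le> ennreal (1 / (1 / 2) * (\<integral>\<omega>. \<psi> (X \<omega>) \<partial>L))"
    using bnd XN by (intro integral_Markov_inequality[OF int]) (auto intro!: AE_I2)
  also have "\<dots> \<le> ennreal (2 * \<beta>)" using le by (intro ennreal_leI) simp
  finally show ?thesis .
qed

abbreviation hist_law ::
  "('p, 's, 'a) mdp_family \<Rightarrow> 's measure \<Rightarrow> ('s, 'a) policy \<Rightarrow> nat \<Rightarrow> 'p \<Rightarrow> ('s, 'a) history measure" where
  "hist_law M \<rho> \<pi> t \<theta> \<equiv> distr (law M \<rho> \<pi> \<theta>) (hist_space M t) (hist t)"

text \<open>At most \<open>3 * exp L\<close> balls of the \<nu>-distance with centres in the shell
  cover the shell. Each centre has \<mu>-distance more than \<open>a\<close> from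
  \<open>\<theta>0\<close>, so its test has errors at most \<open>\<beta>\<close> and its
  alternative contains the whole ball. In the union of the critical regions only the null error pays
  for the number of balls.\<close>

lemma shell_test:
  assumes M: "is_mdp_family M" and \<pi>: "is_policy M \<pi>"
    and \<rho>: "\<rho> \<in> space (prob_algebra (State M))" and \<theta>0: "\<theta>0 \<in> space (Param M)"
    and sets: "sets lam = sets (SA M)" and \<nu>: "\<nu> \<in> borel_measurable (SA M)"
    and \<alpha>: "\<And>i. 0 < \<alpha> i"
    and testing: "testing_constants M \<pi> lam \<theta>0 k l \<alpha> \<mu> \<nu> K \<xi>"
    and t: "k + l \<le> t"
    and ab: "0 < a" "b < e" "2 * e\<^sup>2 \<le> 3 * a\<^sup>2" "0 < b"
    and A: "A = {\<theta>\<in>space (Param M). ennreal a < semidist M lam \<mu> \<theta> \<theta>0 \<and> semidist M lam \<mu> \<theta> \<theta>0 \<le> ennreal b}"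
    and cov: "ln_enat (covering_number (1 / 2 * sqrt (\<alpha> (last_block k l t)) * \<xi> * e) (space (Param M))
        {\<theta>\<in>space (Param M). semidist M lam \<mu> \<theta> \<theta>0 < ennreal e} (semidist M lam \<nu>)) \<le> ereal L"
  shows "\<exists>T\<in>sets (hist_space M t).
    emeasure (hist_law M \<rho> \<pi> t \<theta>0) T \<le> ennreal (6 * exp (L - K * block_sum k l \<alpha> t * a\<^sup>2)) \<and>
    (\<forall>\<theta>\<in>A. emeasure (hist_law M \<rho> \<pi> t \<theta>) (space (hist_space M t) - T)
      \<le> ennreal (2 * exp (- (K * block_sum k l \<alpha> t * a\<^sup>2))))"
proof -
  let ?H = "hist_space M t" and ?Q = "hist_law M \<rho> \<pi> t"
  \<comment> \<open>For every centre in the shell, \<open>q * a\<close> is a lower bound for the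
    radius of the alternative of its test.\<close>
  define q where "q = sqrt (\<alpha> (last_block k l t)) * \<xi>"
  define \<beta> where "\<beta> = exp (- (K * block_sum k l \<alpha> t * a\<^sup>2))"
  have K: "0 < K" and \<xi>: "0 < \<xi>" using testing by (auto simp: testing_constants_def)
  have q: "0 < q" using \<alpha> \<xi> by (simp add: q_def)
  have bs: "0 \<le> block_sum k l \<alpha> t"
    by (simp add: block_sum_def sum_nonneg less_imp_le[OF \<alpha>])
  have AT: "A \<subseteq> {\<theta>\<in>space (Param M). semidist M lam \<mu> \<theta> \<theta>0 < ennreal e}"
    using ab by (auto simp: A intro: order_le_less_trans simp: ennreal_lessI)
  \<comment> \<open>The covering radius is \<open>q * e / 2\<close>; enlarged by the factor
    \<open>sqrt (8 / 3)\<close> it still does not exceed \<open>q * a\<close>.\<close>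
  have radii: "8 * (1 / 2 * sqrt (\<alpha> (last_block k l t)) * \<xi> * e)\<^sup>2 \<le> 3 * (q * a)\<^sup>2"
  proof -
    have "8 * (1 / 2 * sqrt (\<alpha> (last_block k l t)) * \<xi> * e)\<^sup>2 = q\<^sup>2 * (2 * e\<^sup>2)"
      by (simp add: q_def power_mult_distrib power_divide)
    also have "\<dots> \<le> q\<^sup>2 * (3 * a\<^sup>2)" using ab by (intro mult_left_mono) auto
    finally show ?thesis by (simp add: power_mult_distrib)
  qed
  have nonneg: "0 \<le> 1 / 2 * sqrt (\<alpha> (last_block k l t)) * \<xi> * e" "0 \<le> q * a"
    using ab q \<xi> less_imp_le[OF \<alpha>] by simp_all
  obtain F where F: "finite F" "F \<subseteq> A" "real (card F) \<le> 3 * exp L"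
    and net: "\<And>\<theta>. \<theta> \<in> A \<Longrightarrow> \<exists>x\<in>F. semidist M lam \<nu> \<theta> x \<le> ennreal (q * a)"
    by (rule net_of_covering[OF M sets \<nu> AT _ cov nonneg radii]) auto
  define good where "good x \<phi> \<longleftrightarrow>
      \<phi> \<in> borel_measurable ?H \<and> (\<forall>h\<in>space ?H. 0 \<le> \<phi> h \<and> \<phi> h \<le> 1) \<and>
      (\<integral>\<omega>. \<phi> (hist t \<omega>) \<partial>law M \<rho> \<pi> \<theta>0) \<le> \<beta> \<and>
      (\<forall>\<theta>\<in>space (Param M). semidist M lam \<nu> \<theta> x \<le> ennreal (q * a) \<longrightarrow>
        (\<integral>\<omega>. 1 - \<phi> (hist t \<omega>) \<partial>law M \<rho> \<pi> \<theta>) \<le> \<beta>)" for x \<phi>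
  have "\<exists>\<phi>. good x \<phi>" if "x \<in> F" for x
  proof -
    have x: "x \<in> space (Param M)" "ennreal a < semidist M lam \<mu> \<theta>0 x" "semidist M lam \<mu> \<theta>0 x \<le> ennreal b"
      using F(2) that by (auto simp: A semidist_commute[of M lam \<mu> \<theta>0])
    define \<beta>' where "\<beta>' = exp (- K * (block_sum k l \<alpha> t * (enn2real (semidist M lam \<mu> \<theta>0 x))\<^sup>2))"
    \<comment> \<open>The outer radius \<open>b\<close> excludes the value infinity, which
      \<open>enn2real\<close> would send to 0.\<close>
    have "a \<le> enn2real (semidist M lam \<mu> \<theta>0 x)"
      using x(2,3) ab by (cases "semidist M lam \<mu> \<theta>0 x") (auto simp: ennreal_less_iff top_unique)
    then have "a\<^sup>2 \<le> (enn2real (semidist M lam \<mu> \<theta>0 x))\<^sup>2" using ab by (intro power_mono) auto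
    then have "K * block_sum k l \<alpha> t * a\<^sup>2 \<le> K * block_sum k l \<alpha> t * (enn2real (semidist M lam \<mu> \<theta>0 x))\<^sup>2"
      using K bs by (intro mult_left_mono) auto
    then have \<beta>': "\<beta>' \<le> \<beta>" by (simp add: \<beta>'_def \<beta>_def mult.assoc)
    have inB: "semidist M lam \<nu> \<theta> x
        \<le> ennreal (\<xi> * sqrt (\<alpha> (last_block k l t))) * semidist M lam \<mu> \<theta>0 x"
      if "semidist M lam \<nu> \<theta> x \<le> ennreal (q * a)" for \<theta>
    proof -
      have "ennreal (q * a) = ennreal (\<xi> * sqrt (\<alpha> (last_block k l t))) * ennreal a"
        using ab \<alpha>[of "last_block k l t"] \<xi> by (simp add: q_def ennreal_mult mult_ac)
      also have "\<dots> \<le> ennreal (\<xi> * sqrt (\<alpha> (last_block k l t))) * semidist M lam \<mu> \<theta>0 x"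
        using x(2) by (intro mult_left_mono) auto
      finally show ?thesis using that by (rule order_trans[rotated])
    qed
    \<comment> \<open>The test is chosen before the distribution of the initial state; its bounds
      are then taken at \<rho>.\<close>
    obtain \<phi> where "\<phi> \<in> borel_measurable ?H" "\<forall>h\<in>space ?H. 0 \<le> \<phi> h \<and> \<phi> h \<le> 1"
      "(\<integral>\<omega>. \<phi> (hist t \<omega>) \<partial>law M \<rho> \<pi> \<theta>0) \<le> \<beta>'"
      "\<And>\<theta>. \<theta> \<in> space (Param M) \<Longrightarrow> semidist M lam \<nu> \<theta> x
          \<le> ennreal (\<xi> * sqrt (\<alpha> (last_block k l t))) * semidist M lam \<mu> \<theta>0 x \<Longrightarrow>
        (\<integral>\<omega>. 1 - \<phi> (hist t \<omega>) \<partial>law M \<rho> \<pi> \<theta>) \<le> \<beta>'"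
      using testing t x(1) \<rho> unfolding testing_constants_def Let_def \<beta>'_def by fast
    then show ?thesis using inB unfolding good_def by (intro exI[of _ \<phi>]) (auto intro: order_trans[OF _ \<beta>'])
  qed
  then obtain \<phi> where good: "\<And>x. x \<in> F \<Longrightarrow> good x (\<phi> x)" by metis
  have \<phi>: "\<And>x. x \<in> F \<Longrightarrow> \<phi> x \<in> borel_measurable ?H"
    "\<And>x h. x \<in> F \<Longrightarrow> h \<in> space ?H \<Longrightarrow> 0 \<le> \<phi> x h \<and> \<phi> x h \<le> 1"
    "\<And>x. x \<in> F \<Longrightarrow> (\<integral>\<omega>. \<phi> x (hist t \<omega>) \<partial>law M \<rho> \<pi> \<theta>0) \<le> \<beta>"
    "\<And>x \<theta>. x \<in> F \<Longrightarrow> \<theta> \<in> space (Param M) \<Longrightarrow> semidist M lam \<nu> \<theta> x \<le> ennreal (q * a) \<Longrightarrow>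
      (\<integral>\<omega>. 1 - \<phi> x (hist t \<omega>) \<partial>law M \<rho> \<pi> \<theta>) \<le> \<beta>"
    using good unfolding good_def by blast+
  have hist: "hist t \<in> law M \<rho> \<pi> \<theta> \<rightarrow>\<^sub>M ?H" if "\<theta> \<in> space (Param M)" for \<theta>
    unfolding measurable_cong_sets[OF sets_law[OF M \<pi> \<rho> that] refl] by (rule measurable_hist)
  define R where "R x = {h \<in> space ?H. 1 / 2 \<le> \<phi> x h}" for x
  have R: "R x \<in> sets ?H" if "x \<in> F" for x
    unfolding R_def using \<phi>(1)[OF that] by measurable
  show ?thesis
  proof (intro bexI conjI ballI)
    show T: "(\<Union>x\<in>F. R x) \<in> sets ?H" using R F(1) by auto
    have "emeasure (?Q \<theta>0) (\<Union>x\<in>F. R x) \<le> (\<Sum>x\<in>F. emeasure (?Q \<theta>0) (R x))"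
      using R F(1) by (intro emeasure_subadditive_finite) auto
    also have "\<dots> \<le> (\<Sum>x\<in>F. ennreal (2 * \<beta>))"
      unfolding R_def using \<phi>
      by (intro sum_mono emeasure_half_test[OF prob_space_law[OF M \<pi> \<rho> \<theta>0] hist[OF \<theta>0]]) auto
    also have "\<dots> = ennreal (real (card F) * (2 * \<beta>))"
      by (simp add: ennreal_mult \<beta>_def ennreal_of_nat_eq_real_of_nat)
    also have "\<dots> \<le> ennreal (3 * exp L * (2 * \<beta>))"
      using F(3) by (intro ennreal_leI mult_right_mono) (auto simp: \<beta>_def)
    \<comment> \<open>The factor 6 consists of three centres per covering ball and the doubling by
      the threshold.\<close>
    also have "3 * exp L * (2 * \<beta>) = 6 * exp (L - K * block_sum k l \<alpha> t * a\<^sup>2)"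
      by (simp add: \<beta>_def exp_diff exp_minus divide_inverse)
    finally show "emeasure (?Q \<theta>0) (\<Union>x\<in>F. R x)
      \<le> ennreal (6 * exp (L - K * block_sum k l \<alpha> t * a\<^sup>2))" .
  next
    fix \<theta> assume "\<theta> \<in> A"
    then obtain x where x: "x \<in> F" "semidist M lam \<nu> \<theta> x \<le> ennreal (q * a)" using net by blast
    have \<theta>: "\<theta> \<in> space (Param M)" using \<open>\<theta> \<in> A\<close> by (simp add: A)
    have m: "(\<lambda>h. 1 - \<phi> x h) \<in> borel_measurable ?H" using \<phi>(1)[OF x(1)] by measurable
    \<comment> \<open>A history outside the union avoids in particular the region of the centre near
      \<theta>, where \<open>1 - \<phi> x\<close> would otherwise be small.\<close>
    have "emeasure (?Q \<theta>) (space ?H - (\<Union>x\<in>F. R x)) \<le> emeasure (?Q \<theta>) {h \<in> space ?H. 1 / 2 \<le> 1 - \<phi> x h}"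
    proof (rule emeasure_mono)
      show "space ?H - (\<Union>x\<in>F. R x) \<subseteq> {h \<in> space ?H. 1 / 2 \<le> 1 - \<phi> x h}"
        using x(1) by (auto simp: R_def)
      have "{h \<in> space ?H. 1 / 2 \<le> 1 - \<phi> x h} \<in> sets ?H" using m by measurable
      then show "{h \<in> space ?H. 1 / 2 \<le> 1 - \<phi> x h} \<in> sets (?Q \<theta>)" by simp
    qed
    also have "\<dots> \<le> ennreal (2 * \<beta>)"
      using \<phi>(2)[OF x(1)] \<phi>(4)[OF x(1) \<theta> x(2)]
      by (intro emeasure_half_test[OF prob_space_law[OF M \<pi> \<rho> \<theta>] hist[OF \<theta>] m]) auto
    finally show "emeasure (?Q \<theta>) (space ?H - (\<Union>x\<in>F. R x))
      \<le> ennreal (2 * exp (- (K * block_sum k l \<alpha> t * a\<^sup>2)))" by (simp add: \<beta>_def)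
  qed
qed

section \<open>The posterior mass outside a ball\<close>

lemma suminf_geometric_ennreal:
  assumes "0 \<le> c" "0 \<le> q" "q < 1"
  shows "(\<Sum>i. ennreal (c * q ^ (J + i))) = ennreal (c * q ^ J / (1 - q))"
proof -
  have "(\<lambda>i. c * q ^ J * q ^ i) sums (c * q ^ J * (1 / (1 - q)))"
    using assms by (intro sums_mult geometric_sums) auto
  then have "(\<lambda>i. c * q ^ (J + i)) sums (c * q ^ J / (1 - q))"
    by (simp add: power_add mult.assoc)
  then show ?thesis
    using assms by (subst suminf_ennreal2) (auto simp: sums_iff)
qed

text \<open>Serves the case of a Kullback-Leibler neighbourhood of prior mass 0. In
  \<open>ennreal\<close>, 0 divided by anything is 0, whatever the value of the evidence.\<close>

lemma posterior_null:
  assumes "A \<in> null_sets P"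
  shows "posterior P g h A = 0"
proof -
  have "AE \<theta> in P. ennreal (g \<theta> h) * indicator A \<theta> = 0"
    using AE_not_in[OF assms] by eventually_elim simp
  then have "(\<integral>\<^sup>+\<theta>\<in>A. ennreal (g \<theta> h) \<partial>P) = 0"
    using nn_integral_cong_AE[of "\<lambda>\<theta>. ennreal (g \<theta> h) * indicator A \<theta>" "\<lambda>_. 0" P] by simp
  then show ?thesis by (simp add: posterior_def)
qed

lemma posterior_mono:
  assumes "A \<subseteq> B"
  shows "posterior P g h A \<le> posterior P g h B"
  unfolding posterior_def using assms
  by (intro divide_right_mono_ennreal nn_integral_mono mult_left_mono) (auto simp: indicator_def)

text \<open>The gain \<open>K * L * j^2 / 2\<close> is split into equal halves. One absorbs
  \<open>(1 + C) * L\<close>, because \<open>j\<close> is at least \<open>4 * (1 + C) / K\<close>;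
  the other dominates a multiple of \<open>j\<close> free of \<open>L\<close>. This gives geometric
  decay in \<open>j\<close>, uniformly in \<open>L \<ge> c0\<close>.\<close>

lemma exponent_bound:
  fixes K C L c0 j :: real
  assumes "0 < K" "0 < c0" "c0 \<le> L" "1 \<le> j" "4 * (1 + C) \<le> K * j"
  shows "(1 + C) * L - K * L * j\<^sup>2 / 2 \<le> - (K * c0 / 4) * j"
proof -
  have "(1 + C) * L \<le> K * j / 4 * L" using assms by (intro mult_right_mono) auto
  also have "\<dots> \<le> K * j / 4 * L * j"
    using assms mult_left_mono[of 1 j "K * j / 4 * L"] by simp
  finally have 1: "(1 + C) * L \<le> K * L * j\<^sup>2 / 4" by (simp add: power2_eq_square mult_ac)
  have "K * c0 / 4 * j \<le> K * L / 4 * j" using assms by (intro mult_right_mono) auto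
  also have "\<dots> \<le> K * L / 4 * j * j"
    using assms mult_left_mono[of 1 j "K * L / 4 * j"] by simp
  finally have "K * c0 / 4 * j \<le> K * L * j\<^sup>2 / 4" by (simp add: power2_eq_square mult_ac)
  with 1 show ?thesis by simp
qed

text \<open>Chebyshev-type bound with deviation \<open>C * L\<close> and moment bound
  \<open>sqrt L ^ n\<close>: the quotient is \<open>(1 / (C * sqrt L)) ^ n\<close>, which is bounded
  uniformly in \<open>L\<close> and \<open>n\<close>.\<close>

lemma KL_nbhd_deviation:
  assumes \<eta>: "g \<theta>0 \<in> borel_measurable \<eta>" "g \<theta> \<in> borel_measurable \<eta>"
    and nonneg: "\<And>h. h \<in> space \<eta> \<Longrightarrow> 0 \<le> g \<theta> h"
    and \<theta>: "\<theta> \<in> KL_nbhd \<Theta> \<eta> g t \<theta>0 e n"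
    and L: "real t * e\<^sup>2 = L" "0 < t" "0 \<le> e" and n: "0 < n"
    and c0: "0 < c0" "c0 \<le> L" and C: "0 < C" "1 \<le> C * sqrt c0"
  shows "emeasure (density \<eta> (\<lambda>h. ennreal (g \<theta>0 h)))
    {h \<in> space \<eta>. g \<theta> h < g \<theta>0 h * exp (- ((1 + C) * L))} \<le> ennreal (1 / (C * sqrt c0))"
proof -
  let ?x = "emeasure (density \<eta> (\<lambda>h. ennreal (g \<theta>0 h)))
    {h \<in> space \<eta>. g \<theta> h < g \<theta>0 h * exp (- ((1 + C) * L))}"
  have Lpos: "0 < L" using c0 by simp
  have "sqrt L = sqrt (real t) * e" using L by (simp add: real_sqrt_mult flip: L(1))
  moreover have "real t powr (real n / 2) = sqrt (real t) ^ n"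
    using L(2) by (simp add: powr_half_sqrt[symmetric] powr_realpow[symmetric] powr_powr)
  ultimately have V: "real t powr (real n / 2) * e ^ n = sqrt L ^ n"
    by (simp add: power_mult_distrib)
  have "ennreal ((C * L) ^ n) * emeasure (density \<eta> (\<lambda>h. ennreal (g \<theta>0 h)))
      {h \<in> space \<eta>. g \<theta> h < g \<theta>0 h * exp (- (L + C * L))} \<le> ennreal (sqrt L ^ n)"
    using \<theta> C Lpos unfolding KL_nbhd_def L(1) V
    by (intro KL_deviation[OF \<eta> nonneg]) auto
  then have dev: "ennreal ((C * L) ^ n) * ?x \<le> ennreal (sqrt L ^ n)"
    by (simp add: algebra_simps)
  have "?x = ennreal (1 / (C * L) ^ n) * (ennreal ((C * L) ^ n) * ?x)"
    using C Lpos by (simp add: mult.assoc[symmetric] ennreal_mult[symmetric])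
  also have "\<dots> \<le> ennreal (1 / (C * L) ^ n) * ennreal (sqrt L ^ n)"
    by (intro mult_left_mono dev) simp
  also have "\<dots> = ennreal ((1 / (C * sqrt L)) ^ n)"
  proof -
    have "sqrt L / (C * L) = 1 / (C * sqrt L)"
      using C Lpos by (simp add: field_simps)
    then have "1 / (C * L) ^ n * sqrt L ^ n = (1 / (C * sqrt L)) ^ n"
      by (simp add: power_divide[symmetric])
    then show ?thesis using C Lpos by (simp add: ennreal_mult[symmetric])
  qed
  also have "\<dots> \<le> ennreal (1 / (C * sqrt c0))"
  proof (rule ennreal_leI)
    have "C * sqrt c0 \<le> C * sqrt L" using C c0 by simp
    then have *: "1 / (C * sqrt L) \<le> 1 / (C * sqrt c0)"
      using C c0 by (intro divide_left_mono) auto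
    \<comment> \<open>The base of the power is thus at most 1, so its \<open>n\<close>-th power is
      at most the base itself.\<close>
    have "1 \<le> C * sqrt L" using C \<open>C * sqrt c0 \<le> C * sqrt L\<close> by linarith
    then have "(1 / (C * sqrt L)) ^ n \<le> (1 / (C * sqrt L)) ^ 1"
      using C n Lpos by (intro power_decreasing) auto
    then show "(1 / (C * sqrt L)) ^ n \<le> 1 / (C * sqrt c0)" using * by simp
  qed
  finally show ?thesis .
qed

lemma history_density_measurable:
  assumes "history_density M \<rho> \<pi> \<eta> f" "sets P = sets (Param M)"
  shows "(\<lambda>x. f t (fst x) (snd x)) \<in> borel_measurable (P \<Otimes>\<^sub>M \<eta> t)"
proof -
  have sets\<eta>: "sets (\<eta> t) = sets (hist_space M t)"
    and fm: "(\<lambda>(\<theta>, h). f t \<theta> h) \<in> borel_measurable (Param M \<Otimes>\<^sub>M hist_space M t)"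
    using assms(1) by (auto simp: history_density_def)
  show ?thesis
    unfolding measurable_cong_sets[OF sets_pair_measure_cong[OF assms(2) sets\<eta>] refl]
    using fm by (simp add: case_prod_beta')
qed

lemma measurable_posterior_hist:
  assumes dens: "history_density M \<rho> \<pi> \<eta> f" and P: "P \<in> space (prob_algebra (Param M))"
    and A: "A \<in> sets (Param M)"
  shows "(\<lambda>h. posterior P (f t) h A) \<in> borel_measurable (hist_space M t)"
proof -
  have PP: "prob_space P" and setsP: "sets P = sets (Param M)"
    using P by (auto simp: space_prob_algebra)
  have \<eta>: "sigma_finite_measure (\<eta> t)" and sets\<eta>: "sets (\<eta> t) = sets (hist_space M t)"
    using dens by (auto simp: history_density_def)
  show ?thesis
    using measurable_posterior[OF PP \<eta> history_density_measurable[OF dens setsP], of A] A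
    by (simp add: setsP measurable_cong_sets[OF sets\<eta> refl])
qed

text \<open>A bound at a fixed time whose right side is free of \<open>t\<close> and
  \<open>L\<close>: choosing first \<open>C\<close> and then \<open>J\<close> makes it small for all
  large times at once. The terms with 6 and \<open>4 / \<delta>\<close> come from the null errors
  and the errors on the shells, the last one from the evidence.\<close>

lemma posterior_bound_at:
  fixes J :: nat
  assumes M: "is_mdp_family M" and \<pi>: "is_policy M \<pi>"
    and \<rho>: "\<rho> \<in> space (prob_algebra (State M))" and \<theta>0: "\<theta>0 \<in> space (Param M)"
    and dens: "history_density M \<rho> \<pi> \<eta> f"
    and lam: "finite_measure lam" "sets lam = sets (SA M)"
    and \<mu>: "\<mu> \<in> borel_measurable (SA M)" and \<nu>: "\<nu> \<in> borel_measurable (SA M)"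
    and fin: "\<And>\<theta>. \<theta> \<in> space (Param M) \<Longrightarrow> semidist M lam \<mu> \<theta> \<theta>0 < \<infinity>"
    and \<alpha>: "\<And>i. 0 < \<alpha> i"
    and testing: "testing_constants M \<pi> lam \<theta>0 k l \<alpha> \<mu> \<nu> K \<xi>"
    and n: "0 < n" and P: "P \<in> space (prob_algebra (Param M))"
    and e: "0 < e" and t: "k + l \<le> t" "0 < t"
    and L: "L = block_sum k l \<alpha> t * e\<^sup>2" "real t * eb\<^sup>2 = L" "0 \<le> eb"
    and c0: "0 < c0" "c0 \<le> L"
    and cov: "\<And>e'. e < e' \<Longrightarrow>
      ln_enat (covering_number (1 / 2 * sqrt (\<alpha> (last_block k l t)) * \<xi> * e') (space (Param M))
        {\<theta>\<in>space (Param M). semidist M lam \<mu> \<theta> \<theta>0 < ennreal e'} (semidist M lam \<nu>)) \<le> ereal L"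
    and mass: "\<And>j. J \<le> j \<Longrightarrow> emeasure P {\<theta>\<in>space (Param M).
        ennreal (real j * e) < semidist M lam \<mu> \<theta> \<theta>0 \<and>
        semidist M lam \<mu> \<theta> \<theta>0 \<le> ennreal ((real j + 1) * e)}
      / emeasure P (KL_nbhd (space (Param M)) (\<eta> t) (f t) t \<theta>0 eb n)
      \<le> ennreal (exp (K * L * (real j)\<^sup>2 / 2))"
    and J: "9 \<le> J" "4 * (1 + C) \<le> K * real J"
    and C: "0 < C" "1 \<le> C * sqrt c0" and \<delta>: "0 < \<delta>"
    and q: "q = exp (- (K * c0 / 4))"
  shows "emeasure (hist_law M \<rho> \<pi> t \<theta>0) {h \<in> space (hist_space M t). ennreal \<delta> <
      posterior P (f t) h {\<theta>\<in>space (Param M). ennreal (real J * e) < semidist M lam \<mu> \<theta> \<theta>0}}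
    \<le> ennreal ((6 + 4 / \<delta>) * q ^ J / (1 - q) + 2 / (C * sqrt c0))"
proof -
  let ?H = "hist_space M t" and ?d = "\<lambda>\<theta>. semidist M lam \<mu> \<theta> \<theta>0"
  define B where "B = KL_nbhd (space (Param M)) (\<eta> t) (f t) t \<theta>0 eb n"
  \<comment> \<open>Numbering starts at \<open>J\<close>. A shell excludes its inner and includes
    its outer radius, so that the shells tile the complement of the closed ball of radius
    \<open>J * e\<close>.\<close>
  define S where "S i = {\<theta>\<in>space (Param M). ennreal (real (J + i) * e) < ?d \<theta> \<and>
    ?d \<theta> \<le> ennreal ((real (J + i) + 1) * e)}" for i
  have K: "0 < K" using testing by (simp add: testing_constants_def)
  have q01: "0 < q" "q < 1" using K c0 by (auto simp: q)
  have PP: "prob_space P" and setsP: "sets P = sets (Param M)"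
    using P by (auto simp: space_prob_algebra)
  have spP: "space P = space (Param M)" using setsP by (rule sets_eq_imp_space_eq)
  have \<eta>: "sigma_finite_measure (\<eta> t)" and sets\<eta>: "sets (\<eta> t) = sets ?H"
    and fnn: "\<And>\<theta> h. \<theta> \<in> space (Param M) \<Longrightarrow> h \<in> space ?H \<Longrightarrow> 0 \<le> f t \<theta> h"
    and Q: "\<And>\<theta>. \<theta> \<in> space (Param M) \<Longrightarrow>
      hist_law M \<rho> \<pi> t \<theta> = density (\<eta> t) (\<lambda>h. ennreal (f t \<theta> h))"
    using dens by (auto simp: history_density_def)
  have sp\<eta>: "space (\<eta> t) = space ?H" using sets\<eta> by (rule sets_eq_imp_space_eq)
  have g: "(\<lambda>x. f t (fst x) (snd x)) \<in> borel_measurable (P \<Otimes>\<^sub>M \<eta> t)"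
    by (rule history_density_measurable[OF dens setsP])
  have d_meas[measurable]: "?d \<in> borel_measurable (Param M)"
    by (rule measurable_semidist[OF M lam \<mu> \<theta>0])
  have S: "S i \<in> sets P" for i unfolding S_def setsP by measurable
  have union: "(\<Union>i. S i) = {\<theta>\<in>space (Param M). ennreal (real J * e) < ?d \<theta>}"
  proof (intro equalityI subsetI)
    fix \<theta> assume "\<theta> \<in> (\<Union>i. S i)"
    then obtain i where i: "\<theta> \<in> space (Param M)" "ennreal (real (J + i) * e) < ?d \<theta>" by (auto simp: S_def)
    have "ennreal (real J * e) \<le> ennreal (real (J + i) * e)"
      using e by (intro ennreal_leI mult_right_mono) auto
    then show "\<theta> \<in> {\<theta>\<in>space (Param M). ennreal (real J * e) < ?d \<theta>}" using i by auto
  next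
    fix \<theta> assume "\<theta> \<in> {\<theta>\<in>space (Param M). ennreal (real J * e) < ?d \<theta>}"
    then have \<theta>: "\<theta> \<in> space (Param M)" "ennreal (real J * e) < ?d \<theta>" by auto
    \<comment> \<open>Without a finite distance the parameter would lie in no shell.\<close>
    obtain r where r: "?d \<theta> = ennreal r" "0 \<le> r"
      using fin[OF \<theta>(1)] by (cases "?d \<theta>") auto
    have Jr: "real J < r / e" using \<theta>(2) r e by (simp add: ennreal_less_iff field_simps)
    \<comment> \<open>Rounding up fits shells that include their outer radius; the one with outer
      radius \<open>N * e\<close> has number \<open>N - 1\<close>.\<close>
    define N where "N = nat \<lceil>r / e\<rceil>"
    have N: "r / e \<le> real N" "real N < r / e + 1"
      using r(2) e Jr by (auto simp: N_def) linarith+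
    have "J < N" using Jr N by linarith
    define i where "i = N - 1 - J"
    have iN: "real (J + i) = real N - 1" using \<open>J < N\<close> by (simp add: i_def of_nat_diff)
    have "(real N - 1) * e < r" "r \<le> real N * e" using N e by (auto simp: field_simps)
    then have "\<theta> \<in> S i"
      using \<theta>(1) r iN e J \<open>J < N\<close> unfolding S_def by (auto simp: ennreal_less_iff intro!: ennreal_leI)
    then show "\<theta> \<in> (\<Union>i. S i)" by blast
  qed
  have mass_S: "emeasure P (S i) / emeasure P B \<le> ennreal (exp (K * L * (real (J + i))\<^sup>2 / 2))" for i
    unfolding S_def B_def by (rule mass) simp
  show ?thesis
  \<comment> \<open>In \<open>ennreal\<close> a nonzero number divided by 0 is infinite, so for a
    neighbourhood of mass 0 the bound on the mass ratios makes every shell null.\<close>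
  proof (cases "emeasure P B = 0")
    case True
    have "emeasure P (S i) = 0" for i
    proof (rule ccontr)
      assume "emeasure P (S i) \<noteq> 0"
      then have "emeasure P (S i) / emeasure P B = \<infinity>"
        using True by (simp add: divide_ennreal_def ennreal_mult_top)
      then show False using mass_S[of i] by (simp add: top_unique)
    qed
    then have "(\<Union>i. S i) \<in> null_sets P" using S by (intro null_sets_UN) (auto simp: null_sets_def)
    then have "posterior P (f t) h (\<Union>i. S i) = 0" for h by (rule posterior_null)
    then show ?thesis unfolding union by simp
  next
    case False
    then have B0: "0 < emeasure P B" by (simp add: zero_less_iff_neq_zero)
    \<comment> \<open>\<open>emeasure\<close> is 0 outside the sigma-algebra, so positive mass
      entails measurability.\<close>
    have Bs: "B \<in> sets P" using emeasure_neq_0_sets[OF False] .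
    have fin_B: "emeasure P B \<noteq> \<infinity>"
      using PP by (simp add: finite_measure.emeasure_eq_measure prob_space.finite_measure)
    have exps: "(1 + C) * L - K * L * (real (J + i))\<^sup>2 / 2 \<le> - (K * c0 / 4) * real (J + i)" for i
    proof (rule exponent_bound[OF K c0])
      have "K * real J \<le> K * real (J + i)" using K by simp
      then show "4 * (1 + C) \<le> K * real (J + i)" using J by linarith
    qed (use J in auto)
    have qpow: "exp (- (K * c0 / 4) * real j) = q ^ j" for j
      unfolding q by (subst exp_of_nat_mult[symmetric]) (simp add: mult.commute)
    have KL: "K * block_sum k l \<alpha> t * (real j * e)\<^sup>2 = K * L * (real j)\<^sup>2" for j
      by (simp add: L(1) power_mult_distrib mult_ac)
    define good where "good i T \<longleftrightarrow> T \<in> sets ?H \<and>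
      emeasure (hist_law M \<rho> \<pi> t \<theta>0) T \<le> ennreal (6 * exp (L - K * L * (real (J + i))\<^sup>2)) \<and>
      (\<forall>\<theta>\<in>S i. emeasure (hist_law M \<rho> \<pi> t \<theta>) (space ?H - T)
        \<le> ennreal (2 * exp (- (K * L * (real (J + i))\<^sup>2))))" for i T
    have "\<exists>T. good i T" for i
      unfolding good_def KL[symmetric] Bex_def[symmetric]
    proof (rule shell_test[OF M \<pi> \<rho> \<theta>0 lam(2) \<nu> \<alpha> testing t(1) _ _ _ _ S_def])
      let ?j = "real (J + i)"
      have j: "9 \<le> ?j" using J by simp
      show "0 < ?j * e" "0 < (?j + 1) * e" using j e by auto
      \<comment> \<open>The covered ball is open while the shell contains its outer radius, hence a
        covered ball of radius \<open>(j + 2) * e\<close>.\<close>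
      show "(?j + 1) * e < (?j + 2) * e" using e by simp
      \<comment> \<open>The inequality \<open>2 * (j + 2)^2 \<le> 3 * j^2\<close> amounts to
        \<open>j^2 - 8 * j - 8 \<ge> 0\<close>, and the left side is
        \<open>(j - 9) * (j + 1) + 1\<close>. This is the origin of
        \<open>9 \<le> J\<close>.\<close>
      have "0 \<le> (?j - 9) * (?j + 1) + 1" using j by (intro add_nonneg_nonneg mult_nonneg_nonneg) auto
      then have "2 * (?j + 2)\<^sup>2 \<le> 3 * ?j\<^sup>2" by (simp add: power2_eq_square algebra_simps)
      then have "2 * (?j + 2)\<^sup>2 * e\<^sup>2 \<le> 3 * ?j\<^sup>2 * e\<^sup>2" by (intro mult_right_mono) auto
      then show "2 * ((?j + 2) * e)\<^sup>2 \<le> 3 * (?j * e)\<^sup>2" by (simp add: power_mult_distrib)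
      have "1 * e < (?j + 2) * e" using e by (intro mult_strict_right_mono) auto
      then show "ln_enat (covering_number (1 / 2 * sqrt (\<alpha> (last_block k l t)) * \<xi> * ((?j + 2) * e))
          (space (Param M)) {\<theta>\<in>space (Param M). ?d \<theta> < ennreal ((?j + 2) * e)}
          (semidist M lam \<nu>)) \<le> ereal L"
        by (intro cov) simp
    qed
    then obtain T where good: "\<And>i. good i (T i)" by metis
    have T: "\<And>i. T i \<in> sets ?H"
      "\<And>i. emeasure (hist_law M \<rho> \<pi> t \<theta>0) (T i) \<le> ennreal (6 * exp (L - K * L * (real (J + i))\<^sup>2))"
      "\<And>i \<theta>. \<theta> \<in> S i \<Longrightarrow> emeasure (hist_law M \<rho> \<pi> t \<theta>) (space ?H - T i)
        \<le> ennreal (2 * exp (- (K * L * (real (J + i))\<^sup>2)))"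
      using good unfolding good_def by blast+
    have S_space: "\<theta> \<in> space (Param M)" if "\<theta> \<in> S i" for \<theta> i using that by (simp add: S_def)
    have fmeas: "f t \<theta> \<in> borel_measurable (\<eta> t)" if "\<theta> \<in> space (Param M)" for \<theta>
      using measurable_likelihood[OF PP \<eta> g] that by (simp add: spP)
    \<comment> \<open>The likelihood ratio guaranteed on \<open>B\<close> up to small probability;
      dividing by the evidence costs a factor \<open>1 / c\<close>.\<close>
    define c where "c = exp (- ((1 + C) * L))"
    have "emeasure (density (\<eta> t) (\<lambda>h. ennreal (f t \<theta>0 h)))
        {h \<in> space (\<eta> t). ennreal \<delta> < posterior P (f t) h (\<Union>i. S i)}
      \<le> (\<Sum>i. ennreal (6 * exp (L - K * L * (real (J + i))\<^sup>2))) + 2 * ennreal (1 / (C * sqrt c0))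
        + ennreal (2 / (\<delta> * c)) * (\<Sum>i. ennreal (2 * exp (- (K * L * (real (J + i))\<^sup>2))
          * exp (K * L * (real (J + i))\<^sup>2 / 2)))"
    proof (rule posterior_peeling_bound[OF PP \<eta> g _ Bs B0 _ \<delta> _ S])
      show "\<theta>0 \<in> space P" using \<theta>0 by (simp add: spP)
      show "T i \<in> sets (\<eta> t)" for i using T(1) by (simp add: sets\<eta>)
      show "emeasure (density (\<eta> t) (\<lambda>h. ennreal (f t \<theta>0 h))) (T i)
          \<le> ennreal (6 * exp (L - K * L * (real (J + i))\<^sup>2))" for i
        using T(2)[of i] by (simp add: Q[OF \<theta>0])
      show "emeasure (density (\<eta> t) (\<lambda>h. ennreal (f t \<theta> h))) (space (\<eta> t) - T i)
          \<le> ennreal (2 * exp (- (K * L * (real (J + i))\<^sup>2)))" if "\<theta> \<in> S i" for i \<theta>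
        using T(3)[OF that] by (simp add: Q[OF S_space[OF that]] sp\<eta>)
      show "emeasure P (S i) \<le> ennreal (exp (K * L * (real (J + i))\<^sup>2 / 2)) * emeasure P B" for i
      proof -
        have "emeasure P (S i) = emeasure P (S i) / emeasure P B * emeasure P B"
          using False fin_B by (simp add: ennreal_divide_times ennreal_divide_self less_top)
        also have "\<dots> \<le> ennreal (exp (K * L * (real (J + i))\<^sup>2 / 2)) * emeasure P B"
          by (intro mult_right_mono mass_S) simp
        finally show ?thesis .
      qed
      show "emeasure (density (\<eta> t) (\<lambda>h. ennreal (f t \<theta>0 h))) {h \<in> space (\<eta> t). f t \<theta> h < f t \<theta>0 h * c}
          \<le> ennreal (1 / (C * sqrt c0))" if "\<theta> \<in> B" for \<theta>
      proof -
        have \<theta>: "\<theta> \<in> space (Param M)" using that by (simp add: B_def KL_nbhd_def)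
        show ?thesis
          unfolding c_def
          by (rule KL_nbhd_deviation[where g = "f t" and t = t and e = eb and n = n])
             (use fmeas[OF \<theta>0] fmeas[OF \<theta>] fnn[OF \<theta>] that L t n c0 C in \<open>auto simp: B_def sp\<eta>\<close>)
      qed
    qed (auto simp: c_def)
    also have "\<dots> \<le> ennreal (6 * q ^ J / (1 - q)) + ennreal (2 / (C * sqrt c0))
        + ennreal (4 / \<delta> * q ^ J / (1 - q))"
    proof (intro add_mono)
      have "(\<Sum>i. ennreal (6 * exp (L - K * L * (real (J + i))\<^sup>2))) \<le> (\<Sum>i. ennreal (6 * q ^ (J + i)))"
      proof (intro suminf_le ennreal_leI)
        fix i
        have "0 \<le> C * L" "0 \<le> K * L * (real (J + i))\<^sup>2" using C c0 K by auto
        \<comment> \<open>The null errors have room to spare: they carry \<open>L\<close> instead of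
          \<open>(1 + C) * L\<close> and lose no prior mass ratio.\<close>
        then have "L - K * L * (real (J + i))\<^sup>2 \<le> - (K * c0 / 4) * real (J + i)"
          using exps[of i] distrib_right[of 1 C L] by linarith
        then show "6 * exp (L - K * L * (real (J + i))\<^sup>2) \<le> 6 * q ^ (J + i)"
          unfolding qpow[symmetric] by simp
      qed auto
      also have "\<dots> = ennreal (6 * q ^ J / (1 - q))"
        using q01 by (intro suminf_geometric_ennreal) auto
      finally show "(\<Sum>i. ennreal (6 * exp (L - K * L * (real (J + i))\<^sup>2))) \<le> ennreal (6 * q ^ J / (1 - q))" .
      show "2 * ennreal (1 / (C * sqrt c0)) \<le> ennreal (2 / (C * sqrt c0))"
        using C by (simp add: ennreal_mult'[symmetric] flip: ennreal_numeral)
      have "ennreal (2 / (\<delta> * c)) * (\<Sum>i. ennreal (2 * exp (- (K * L * (real (J + i))\<^sup>2))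
          * exp (K * L * (real (J + i))\<^sup>2 / 2)))
        = (\<Sum>i. ennreal (2 / (\<delta> * c)) * ennreal (2 * exp (- (K * L * (real (J + i))\<^sup>2))
          * exp (K * L * (real (J + i))\<^sup>2 / 2)))"
        by (rule ennreal_suminf_cmult[symmetric])
      also have "\<dots> \<le> (\<Sum>i. ennreal (4 / \<delta> * q ^ (J + i)))"
      proof (intro suminf_le)
        fix i
        let ?x = "K * L * (real (J + i))\<^sup>2"
        have "2 / (\<delta> * c) * (2 * exp (- ?x) * exp (?x / 2)) = 4 / \<delta> * (exp ((1 + C) * L) * (exp (- ?x) * exp (?x / 2)))"
          using \<delta> unfolding c_def exp_minus[of "(1 + C) * L"] by (simp add: field_simps)
        also have "\<dots> = 4 / \<delta> * exp ((1 + C) * L - ?x / 2)"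
          by (simp add: exp_add[symmetric] field_simps del: exp_add)
        also have "\<dots> \<le> 4 / \<delta> * q ^ (J + i)"
          unfolding qpow[symmetric] using exps[of i] \<delta> by (intro mult_left_mono) auto
        finally show "ennreal (2 / (\<delta> * c)) * ennreal (2 * exp (- ?x) * exp (?x / 2)) \<le> ennreal (4 / \<delta> * q ^ (J + i))"
          using \<delta> by (subst ennreal_mult[symmetric]) (auto simp: c_def intro!: ennreal_leI)
      qed auto
      also have "\<dots> = ennreal (4 / \<delta> * q ^ J / (1 - q))"
        using q01 \<delta> by (intro suminf_geometric_ennreal) auto
      finally show "ennreal (2 / (\<delta> * c)) * (\<Sum>i. ennreal (2 * exp (- (K * L * (real (J + i))\<^sup>2))
          * exp (K * L * (real (J + i))\<^sup>2 / 2))) \<le> ennreal (4 / \<delta> * q ^ J / (1 - q))" .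
    qed
    also have "\<dots> = ennreal ((6 + 4 / \<delta>) * q ^ J / (1 - q) + 2 / (C * sqrt c0))"
      using q01 C c0 \<delta> by (simp add: ennreal_plus[symmetric] add_divide_distrib distrib_right add_ac del: ennreal_plus)
    finally show ?thesis unfolding union sp\<eta> Q[OF \<theta>0] .
  qed
qed

section \<open>Convergence of the posterior in probability\<close>

theorem theorem2p2:
  fixes M :: "('p, 's, 'a) mdp_family"
    and \<rho> :: "'s measure"
    and \<pi> :: "('s, 'a) policy"
    and lam :: "('s \<times> 'a) measure"
    and \<theta>0 :: 'p
    and k l n :: nat
    and \<alpha> \<epsilon> :: "nat \<Rightarrow> real"
    and \<mu> \<nu> :: "'s \<times> 'a \<Rightarrow> real"
    and K \<xi> :: real
    and prior :: "nat \<Rightarrow> 'p measure"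
    and \<eta> :: "nat \<Rightarrow> ('s, 'a) history measure"
    and f :: "nat \<Rightarrow> 'p \<Rightarrow> ('s, 'a) history \<Rightarrow> real"
  assumes mdp: "is_mdp_family M"
    and pol: "is_policy M \<pi>"
    and init: "\<rho> \<in> space (prob_algebra (State M))"
    and true_param: "\<theta>0 \<in> space (Param M)"
    and dens: "history_density M \<rho> \<pi> \<eta> f"
    and lam: "finite_measure lam" "sets lam = sets (SA M)"
    and cond_ac: "\<And>\<theta> i j x. \<theta> \<in> space (Param M) \<Longrightarrow> x \<in> possible_ext_hist M i \<Longrightarrow> 1 \<le> j \<Longrightarrow>
            absolutely_continuous lam (cond_law M \<rho> \<pi> \<theta> i j x)"
    and kl_pos: "0 < k" "0 < l"
    and alpha: "\<And>i. 0 < \<alpha> i" "antimono \<alpha>"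
    and mu: "\<mu> \<in> borel_measurable (SA M)" "\<And>z. z \<in> space (SA M) \<Longrightarrow> 0 \<le> \<mu> z"
    and nu: "\<nu> \<in> borel_measurable (SA M)" "\<And>z. z \<in> space (SA M) \<Longrightarrow> 0 \<le> \<nu> z"
    and lower: "\<And>\<theta> i x. \<theta> \<in> space (Param M) \<Longrightarrow> x \<in> possible_ext_hist M i \<Longrightarrow>
            AE z in lam. ennreal (\<alpha> i * \<mu> z)
              \<le> (\<Sum>j = 1..k. cond_density M lam \<rho> \<pi> \<theta> i j x z) / of_nat k"
    and upper: "\<And>\<theta> i x. \<theta> \<in> space (Param M) \<Longrightarrow> x \<in> possible_ext_hist M i \<Longrightarrow>
            AE z in lam. cond_density M lam \<rho> \<pi> \<theta> i l x z \<le> ennreal (\<nu> z)"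
    and testing: "testing_constants M \<pi> lam \<theta>0 k l \<alpha> \<mu> \<nu> K \<xi>"
    and n_pos: "0 < n"
    and prior: "\<And>t. prior t \<in> space (prob_algebra (Param M))"
    and eps_pos: "\<And>t. 0 < \<epsilon> t" and eps_lim: "\<epsilon> \<longlonglongrightarrow> 0"
    and rate: "(\<lambda>t. 1 / (real t * (eps_bar k l \<alpha> \<epsilon> t)\<^sup>2)) \<in> O(\<lambda>_. 1)"
    and entropy_and_prior_mass: "\<forall>\<^sub>F j in sequentially. \<forall>t\<ge>k + l.
            (SUP e\<in>{\<epsilon> t<..}. ln_enat (covering_number (1 / 2 * sqrt (\<alpha> (last_block k l t)) * \<xi> * e)
                (space (Param M))
                {\<theta>\<in>space (Param M). semidist M lam \<mu> \<theta> \<theta>0 < ennreal e}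
                (semidist M lam \<nu>)))
              \<le> ereal (real t * (eps_bar k l \<alpha> \<epsilon> t)\<^sup>2) \<and>
            emeasure (prior t) {\<theta>\<in>space (Param M).
                ennreal (real j * \<epsilon> t) < semidist M lam \<mu> \<theta> \<theta>0 \<and>
                semidist M lam \<mu> \<theta> \<theta>0 \<le> ennreal ((real j + 1) * \<epsilon> t)}
              / emeasure (prior t) (KL_nbhd (space (Param M)) (\<eta> t) (f t) t \<theta>0 (eps_bar k l \<alpha> \<epsilon> t) n)
              \<le> ennreal (exp (K * real t * (eps_bar k l \<alpha> \<epsilon> t)\<^sup>2 * (real j)\<^sup>2 / 2))"
  shows "\<forall>Mt :: nat \<Rightarrow> real. filterlim Mt at_top sequentially \<longrightarrow>
           (\<forall>\<delta>>0. (\<lambda>t. \<P>(\<omega> in law M \<rho> \<pi> \<theta>0.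
                ennreal \<delta> < posterior (prior t) (f t) (hist t \<omega>)
                  {\<theta>\<in>space (Param M). ennreal (Mt t * \<epsilon> t) < semidist M lam \<mu> \<theta> \<theta>0}))
              \<longlonglongrightarrow> 0)"
proof (intro allI impI)
  fix Mt :: "nat \<Rightarrow> real" and \<delta> :: real
  assume Mt: "filterlim Mt at_top sequentially" and \<delta>: "0 < \<delta>"
  let ?d = "\<lambda>\<theta>. semidist M lam \<mu> \<theta> \<theta>0"
  define L where "L t = real t * (eps_bar k l \<alpha> \<epsilon> t)\<^sup>2" for t
  define A where "A t r = {\<theta>\<in>space (Param M). ennreal (r * \<epsilon> t) < ?d \<theta>}" for t r
  have K: "0 < K" using testing by (simp add: testing_constants_def)

  define cover where "cover t \<longleftrightarrow>
    (SUP e\<in>{\<epsilon> t<..}. ln_enat (covering_number (1 / 2 * sqrt (\<alpha> (last_block k l t)) * \<xi> * e)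
      (space (Param M)) {\<theta>\<in>space (Param M). ?d \<theta> < ennreal e} (semidist M lam \<nu>))) \<le> ereal (L t)" for t
  define mass where "mass j t \<longleftrightarrow>
    emeasure (prior t) {\<theta>\<in>space (Param M). ennreal (real j * \<epsilon> t) < ?d \<theta> \<and>
        ?d \<theta> \<le> ennreal ((real j + 1) * \<epsilon> t)}
      / emeasure (prior t) (KL_nbhd (space (Param M)) (\<eta> t) (f t) t \<theta>0 (eps_bar k l \<alpha> \<epsilon> t) n)
      \<le> ennreal (exp (K * L t * (real j)\<^sup>2 / 2))" for j t
  have hyp: "\<forall>\<^sub>F j in sequentially. \<forall>t\<ge>k + l. cover t \<and> mass j t"
    using entropy_and_prior_mass unfolding cover_def mass_def L_def mult.assoc[of K] .

  obtain x where x: "x \<in> possible_ext_hist M 0"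
    using possible_ext_hist_0_nonempty[OF mdp pol init true_param] by blast
  \<comment> \<open>The lower bound at time 0, with constant \<open>\<alpha> 0\<close>, already
    makes \<mu> integrable.\<close>
  have "(\<integral>\<^sup>+z. ennreal (\<mu> z) \<partial>lam) < \<infinity>"
    using mu(1) unfolding measurable_cong_sets[OF lam(2) refl, symmetric]
    by (intro nn_integral_weight_finite[OF mdp pol init true_param alpha(1) kl_pos(1) _ x lower[OF true_param x]])
  then have fin: "?d \<theta> < \<infinity>" if "\<theta> \<in> space (Param M)" for \<theta>
    by (rule semidist_finite[OF mdp lam(2) mu(1) _ that true_param])

  have bs: "0 < block_sum k l \<alpha> t" if "k + l \<le> t" for t
  proof -
    have "0 < t div (k + l)" using that kl_pos by (simp add: div_greater_zero_iff)
    then show ?thesis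
      unfolding block_sum_def using alpha(1) by (intro sum_pos) auto
  qed
  have L_eq: "L t = block_sum k l \<alpha> t * (\<epsilon> t)\<^sup>2" and L_pos: "0 < L t" if "k + l \<le> t" for t
    using bs[OF that] eps_pos[of t] that kl_pos by (auto simp: L_def eps_bar_def)

  \<comment> \<open>Boundedness of \<open>1 / L t\<close> is turned into the lower bound
    \<open>c0 = 1 / c\<close> for \<open>L t\<close> at large \<open>t\<close>.\<close>
  obtain c where c: "0 < c" "\<forall>\<^sub>F t in sequentially. norm (1 / L t) \<le> c * norm (1 :: real)"
    using rate unfolding L_def by (elim landau_o.bigE) auto
  define c0 where "c0 = 1 / c"
  have c0: "0 < c0" using c(1) by (simp add: c0_def)
  have ev_L: "\<forall>\<^sub>F t in sequentially. k + l \<le> t \<and> c0 \<le> L t"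
    using c(2) eventually_ge_at_top[of "k + l"]
  proof eventually_elim
    case (elim t)
    then have "1 / L t \<le> c" using L_pos[of t] by simp
    then show ?case using elim L_pos[of t] c(1) by (simp add: c0_def field_simps)
  qed

  show "(\<lambda>t. \<P>(\<omega> in law M \<rho> \<pi> \<theta>0. ennreal \<delta> < posterior (prior t) (f t) (hist t \<omega>)
      {\<theta>\<in>space (Param M). ennreal (Mt t * \<epsilon> t) < ?d \<theta>})) \<longlonglongrightarrow> 0"
  proof (rule order_tendstoI)
    fix \<tau> :: real assume \<tau>: "0 < \<tau>"
    \<comment> \<open>The value 4/\<tau> makes the evidence term at most half of \<tau>; the maximum
      with 1 meets the requirement of the moment bound.\<close>
    define C where "C = max 1 (4 / \<tau>) / sqrt c0"
    have C: "0 < C" "C * sqrt c0 = max 1 (4 / \<tau>)" using c0 by (auto simp: C_def)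
    have "2 / (C * sqrt c0) \<le> 2 / (4 / \<tau>)"
      unfolding C(2) using \<tau> by (intro divide_left_mono) auto
    then have C\<tau>: "2 / (C * sqrt c0) \<le> \<tau> / 2" using \<tau> by simp
    define q where "q = exp (- (K * c0 / 4))"
    have q: "0 < q" "q < 1" using K c0 by (auto simp: q_def)

    \<comment> \<open>With \<open>C\<close> fixed, the geometric tail from \<open>J\<close> on gets
      the other half of \<tau>. The choice of \<open>J\<close> is made before \<open>t\<close> is
      considered.\<close>
    have "(\<lambda>j. (6 + 4 / \<delta>) * q ^ j / (1 - q)) \<longlonglongrightarrow> (6 + 4 / \<delta>) * 0 / (1 - q)"
      using q by (intro tendsto_intros LIMSEQ_power_zero) auto
    then have "\<forall>\<^sub>F j in sequentially. (6 + 4 / \<delta>) * q ^ j / (1 - q) < \<tau> / 2"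
      using \<tau> by (intro order_tendstoD(2)) auto
    moreover have "\<forall>\<^sub>F j in sequentially. 9 \<le> j \<and> 4 * (1 + C) / K \<le> real j"
      using eventually_ge_at_top[of 9] eventually_ge_at_top[of "nat \<lceil>4 * (1 + C) / K\<rceil>"]
      by eventually_elim linarith
    \<comment> \<open>The peeling uses every shell from \<open>J\<close> outwards, so the hypothesis
      is needed for all indices beyond \<open>J\<close> simultaneously.\<close>
    moreover note eventually_all_ge_at_top[OF hyp]
    ultimately have "\<forall>\<^sub>F j in sequentially. (6 + 4 / \<delta>) * q ^ j / (1 - q) < \<tau> / 2 \<and>
        (9 \<le> j \<and> 4 * (1 + C) / K \<le> real j) \<and> (\<forall>j'\<ge>j. \<forall>t\<ge>k + l. cover t \<and> mass j' t)"
      by eventually_elim blast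
    from eventually_happens'[OF sequentially_bot this]
    obtain J where J: "(6 + 4 / \<delta>) * q ^ J / (1 - q) < \<tau> / 2" "9 \<le> J" "4 * (1 + C) \<le> K * real J"
      and hyp_J: "\<And>j t. J \<le> j \<Longrightarrow> k + l \<le> t \<Longrightarrow> cover t \<and> mass j t"
      using K by (auto simp: field_simps)

    show "\<forall>\<^sub>F t in sequentially. \<P>(\<omega> in law M \<rho> \<pi> \<theta>0. ennreal \<delta> < posterior (prior t) (f t) (hist t \<omega>)
        {\<theta>\<in>space (Param M). ennreal (Mt t * \<epsilon> t) < ?d \<theta>}) < \<tau>"
      using ev_L filterlim_at_top_dense[THEN iffD1, OF Mt, rule_format, of "real J"]
    proof eventually_elim
      case (elim t)
      then have t: "k + l \<le> t" "0 < t" "c0 \<le> L t" "real J < Mt t" using kl_pos by auto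
      let ?H = "hist_space M t"
      interpret law: prob_space "law M \<rho> \<pi> \<theta>0"
        by (rule prob_space_law[OF mdp pol init true_param])
      have hist: "hist t \<in> law M \<rho> \<pi> \<theta>0 \<rightarrow>\<^sub>M ?H"
        unfolding measurable_cong_sets[OF sets_law[OF mdp pol init true_param] refl] by (rule measurable_hist)
      have "emeasure (hist_law M \<rho> \<pi> t \<theta>0)
          {h \<in> space ?H. ennreal \<delta> < posterior (prior t) (f t) h (A t (real J))}
        \<le> ennreal ((6 + 4 / \<delta>) * q ^ J / (1 - q) + 2 / (C * sqrt c0))"
        unfolding A_def
      proof (rule posterior_bound_at[OF mdp pol init true_param dens lam mu(1) nu(1) fin alpha(1) testing n_pos prior eps_pos t(1,2) L_eq[OF t(1)] _ _ c0 t(3) _ _ J(2,3) C(1) _ \<delta> q_def])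
        show "real t * (eps_bar k l \<alpha> \<epsilon> t)\<^sup>2 = L t" by (simp add: L_def)
        show "0 \<le> eps_bar k l \<alpha> \<epsilon> t"
          using bs[OF t(1)] by (simp add: eps_bar_def)
        show "1 \<le> C * sqrt c0" by (simp add: C(2))
        show "ln_enat (covering_number (1 / 2 * sqrt (\<alpha> (last_block k l t)) * \<xi> * e') (space (Param M))
            {\<theta>\<in>space (Param M). ?d \<theta> < ennreal e'} (semidist M lam \<nu>)) \<le> ereal (L t)"
          if "\<epsilon> t < e'" for e'
          using hyp_J[OF order_refl t(1)] that by (auto simp: cover_def SUP_le_iff)
      qed (use hyp_J t(1) in \<open>auto simp: mass_def\<close>)
      also have "\<dots> < ennreal \<tau>"
        using J(1) C\<tau> \<tau> by (intro ennreal_lessI) auto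
      finally have bound: "emeasure (hist_law M \<rho> \<pi> t \<theta>0)
        {h \<in> space ?H. ennreal \<delta> < posterior (prior t) (f t) h (A t (real J))} < ennreal \<tau>" .
      \<comment> \<open>As \<open>Mt\<close> diverges, the multiple \<open>J\<close> is eventually
        smaller than \<open>Mt t\<close>, and the bound for the larger complement carries
        over.\<close>
      have "A t (Mt t) \<subseteq> A t (real J)"
      proof -
        have "ennreal (real J * \<epsilon> t) \<le> ennreal (Mt t * \<epsilon> t)"
          using t(4) eps_pos[of t] by (intro ennreal_leI mult_right_mono) auto
        then show ?thesis by (auto simp: A_def)
      qed
      then have "{\<omega> \<in> space (law M \<rho> \<pi> \<theta>0). ennreal \<delta> < posterior (prior t) (f t) (hist t \<omega>) (A t (Mt t))}
        \<subseteq> hist t -` {h \<in> space ?H. ennreal \<delta> < posterior (prior t) (f t) h (A t (real J))}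
          \<inter> space (law M \<rho> \<pi> \<theta>0)"
        using measurable_space[OF hist] by (auto intro: order_less_le_trans[OF _ posterior_mono])
      moreover have meas: "{h \<in> space ?H. ennreal \<delta> < posterior (prior t) (f t) h (A t (real J))} \<in> sets ?H"
      proof -
        note [measurable] = measurable_semidist[OF mdp lam mu(1) true_param]
        have "A t (real J) \<in> sets (Param M)" unfolding A_def by measurable
        from measurable_posterior_hist[OF dens prior this]
        show ?thesis by measurable
      qed
      ultimately have "emeasure (law M \<rho> \<pi> \<theta>0)
          {\<omega> \<in> space (law M \<rho> \<pi> \<theta>0). ennreal \<delta> < posterior (prior t) (f t) (hist t \<omega>) (A t (Mt t))}
        \<le> emeasure (hist_law M \<rho> \<pi> t \<theta>0)
          {h \<in> space ?H. ennreal \<delta> < posterior (prior t) (f t) h (A t (real J))}"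
        unfolding emeasure_distr[OF hist meas]
        by (intro emeasure_mono measurable_sets[OF hist meas])
      also note bound
      finally show ?case
        unfolding A_def using \<tau> by (simp add: law.emeasure_eq_measure ennreal_less_iff)
    qed
  \<comment> \<open>The other half of the limit concerns negative lower bounds and holds because
    probabilities are nonnegative.\<close>
  qed (auto intro!: always_eventually order_less_le_trans[OF _ measure_nonneg])
qed

end
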